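(* Let $(M,g)$ be a Riemannian manifold of dimension $n$ and let $\tilde g_2$ be the $0$-homogeneous lift of $g$ to the slit tangent bundle $\widetilde{TM}$. Then: (1) the pair $(\widetilde{TM},\tilde g_2)$ is a pseudo-Riemannian space, depending only on the metric $g$ (that is, $\tilde g_2$ is a globally well-defined, coordinate-independent pseudo-Riemannian metric on $\widetilde{TM}$ determined by $g$); (2) $\tilde g_2$ is $0$-homogeneous on the fibers of the tangent bundle $TM$.
   Context: Let $(x^i)$ be local coordinates on $M$, $(x^i,y^i)$ the induced coordinates on $TM$, $\widetilde{TM}=TM\setminus\{0\}$ the tangent bundle minus its zero section, $g_{ij}$ the components of $g$, $\Gamma_{ij}{}^k$ the Christoffel symbols of its Levi-Civita connection; the summation convention is used. Put $\|y\|=\sqrt{g_{ij}(x)y^iy^j}$. Define the local frame $X_i=\frac{\partial}{\partial x^i}-y^a\Gamma_{ai}{}^m\frac{\partial}{\partial y^m}$, $X_{\bar i}=\frac{\partial}{\partial y^i}$ of $T\widetilde{TM}$, with dual coframe $dx^i$, $\delta y^i=dy^i+y^a\Gamma_{aj}{}^i dx^j$. The $0$-homogeneous lift of $g$ is $\tilde g_2=\frac{2}{\|y\|}g_{ij}(x)\,dx^i\,\delta y^j$, i.e. the symmetric $(0,2)$ tensor field with $\tilde g_2(X_i,X_j)=0=\tilde g_2(X_{\bar i},X_{\bar j})$ and $\tilde g_2(X_i,X_{\bar j})=\tilde g_2(X_{\bar j},X_i)=\frac{2}{\|y\|}g_{ij}$. A tensor field $T$ of type $(0,2)$ on $\widetilde{TM}$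 is $0$-homogeneous on the fibers if $h_t^*T=T$ for every $t>0$, where $h_t:(x,y)\mapsto(x,ty)$. *)

theory Defs
  imports "HOL-Analysis.Analysis"
begin

section \<open>Smooth functions and smooth manifolds\<close>

(* Meaningful for open S. *)
primrec differentiable_order_on ::
    "nat \<Rightarrow> 'e::euclidean_space set \<Rightarrow> ('e \<Rightarrow> 'f::real_normed_vector) \<Rightarrow> bool" where
  "differentiable_order_on 0 S f \<longleftrightarrow> continuous_on S f"
| "differentiable_order_on (Suc k) S f \<longleftrightarrow>
     (\<forall>x\<in>S. f differentiable (at x)) \<and>
     (\<forall>v. differentiable_order_on k S (\<lambda>x. frechet_derivative f (at x) v))"

definition smooth_on :: "'e::euclidean_space set \<Rightarrow> ('e \<Rightarrow> 'f::real_normed_vector) \<Rightarrow> bool" where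
  "smooth_on S f \<longleftrightarrow> (\<forall>k. differentiable_order_on k S f)"

(* A chart is a pair (U, phi); the values of phi outside U play no role. *)
type_synonym ('a, 'e) chart = "'a set \<times> ('a \<Rightarrow> 'e)"

type_synonym ('a, 'e) atlas = "('a, 'e) chart set"

definition chart_image :: "('a, 'e) chart \<Rightarrow> 'e set" where
  "chart_image c = snd c ` fst c"

definition chart_inv :: "('a, 'e) chart \<Rightarrow> 'e \<Rightarrow> 'a" where
  "chart_inv c = inv_into (fst c) (snd c)"

definition points :: "('a, 'e) atlas \<Rightarrow> 'a set" where
  "points A = \<Union> (fst ` A)"

definition charts_at :: "('a, 'e) atlas \<Rightarrow> 'a \<Rightarrow> ('a, 'e) chart set" where
  "charts_at A p = {c \<in> A. p \<in> fst c}"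

(* The atlas A is not required to be maximal; a maximal atlas is a special case. *)
definition smooth_manifold :: "'a topology \<Rightarrow> ('a, 'e::euclidean_space) atlas \<Rightarrow> bool" where
  "smooth_manifold T A \<longleftrightarrow>
     Hausdorff_space T \<and> second_countable T \<and> points A = topspace T \<and>
     (\<forall>c\<in>A. openin T (fst c) \<and> open (chart_image c) \<and>
        homeomorphic_map (subtopology T (fst c)) (top_of_set (chart_image c)) (snd c)) \<and>
     (\<forall>c\<in>A. \<forall>d\<in>A. smooth_on (snd c ` (fst c \<inter> fst d)) (snd d \<circ> chart_inv c))"


section \<open>Tangent vectors\<close>

(* A tangent vector at p is the family of its coordinate vectors in all charts of the atlas
   around p, these being related by the differentials of the coordinate changes.  Families
   are set to 0 on the remaining pairs, so that equality of functions is equality of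
   tangent vectors. *)
type_synonym ('a, 'e) tvector = "('a, 'e) chart \<Rightarrow> 'e"

definition tangent_space ::
    "('a, 'e::euclidean_space) atlas \<Rightarrow> 'a \<Rightarrow> ('a, 'e) tvector set" where
  "tangent_space A p = {\<xi>.
     (\<forall>c. c \<notin> charts_at A p \<longrightarrow> \<xi> c = 0) \<and>
     (\<forall>c\<in>charts_at A p. \<forall>d\<in>charts_at A p.
        \<xi> d = frechet_derivative (snd d \<circ> chart_inv c) (at (snd c p)) (\<xi> c))}"

(* The tangent vector at p with coordinate vector v in the chart c. *)
definition tvec ::
    "('a, 'e::euclidean_space) atlas \<Rightarrow> ('a, 'e) chart \<Rightarrow> 'a \<Rightarrow> 'e \<Rightarrow> ('a, 'e) tvector" where
  "tvec A c p v = (\<lambda>d. if d \<in> charts_at A p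
     then frechet_derivative (snd d \<circ> chart_inv c) (at (snd c p)) v else 0)"

definition tangent_map ::
    "('a, 'e::euclidean_space) atlas \<Rightarrow> ('b, 'f::euclidean_space) atlas \<Rightarrow> ('a \<Rightarrow> 'b) \<Rightarrow>
     'a \<Rightarrow> ('a, 'e) tvector \<Rightarrow> ('b, 'f) tvector" where
  "tangent_map A B F p \<xi> = (\<lambda>d. if d \<in> charts_at B (F p)
     then let c = (SOME c. c \<in> charts_at A p) in
       frechet_derivative (snd d \<circ> F \<circ> chart_inv c) (at (snd c p)) (\<xi> c)
     else 0)"


section \<open>Tensor fields of type (0,2) and metrics\<close>

definition bilinear_form_on ::
    "('a, 'e::euclidean_space) tvector set \<Rightarrow>
     (('a, 'e) tvector \<Rightarrow> ('a, 'e) tvector \<Rightarrow> real) \<Rightarrow> bool" where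
  "bilinear_form_on V B \<longleftrightarrow>
     (\<forall>a b. \<forall>X\<in>V. \<forall>Y\<in>V. \<forall>Z\<in>V.
        B (\<lambda>c. a *\<^sub>R X c + b *\<^sub>R Y c) Z = a * B X Z + b * B Y Z \<and>
        B Z (\<lambda>c. a *\<^sub>R X c + b *\<^sub>R Y c) = a * B Z X + b * B Z Y)"

type_synonym ('a, 'e) field02 = "'a \<Rightarrow> ('a, 'e) tvector \<Rightarrow> ('a, 'e) tvector \<Rightarrow> real"

(* No regularity is required here.  Values at arguments that are not tangent vectors are
   normalized to 0, so that equality of functions is equality of tensor fields. *)
definition tensor_field02 ::
    "('a, 'e::euclidean_space) atlas \<Rightarrow> ('a, 'e) field02 \<Rightarrow> bool" where
  "tensor_field02 A G \<longleftrightarrow>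
     (\<forall>p\<in>points A. bilinear_form_on (tangent_space A p) (G p)) \<and>
     (\<forall>p X Y. \<not> (p \<in> points A \<and> X \<in> tangent_space A p \<and> Y \<in> tangent_space A p)
        \<longrightarrow> G p X Y = 0)"

definition smooth_field02 ::
    "('a, 'e::euclidean_space) atlas \<Rightarrow> ('a, 'e) field02 \<Rightarrow> bool" where
  "smooth_field02 A G \<longleftrightarrow> tensor_field02 A G \<and>
     (\<forall>c\<in>A. \<forall>a\<in>Basis. \<forall>b\<in>Basis. smooth_on (chart_image c)
        (\<lambda>x. G (chart_inv c x) (tvec A c (chart_inv c x) a) (tvec A c (chart_inv c x) b)))"

definition symmetric_field02 ::
    "('a, 'e::euclidean_space) atlas \<Rightarrow> ('a, 'e) field02 \<Rightarrow> bool" where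
  "symmetric_field02 A G \<longleftrightarrow>
     (\<forall>p\<in>points A. \<forall>X\<in>tangent_space A p. \<forall>Y\<in>tangent_space A p. G p X Y = G p Y X)"

definition riemannian_manifold ::
    "'a topology \<Rightarrow> ('a, 'e::euclidean_space) atlas \<Rightarrow> ('a, 'e) field02 \<Rightarrow> bool" where
  "riemannian_manifold T A g \<longleftrightarrow>
     smooth_manifold T A \<and> smooth_field02 A g \<and> symmetric_field02 A g \<and>
     (\<forall>p\<in>points A. \<forall>X\<in>tangent_space A p. X \<noteq> (\<lambda>_. 0) \<longrightarrow> g p X X > 0)"

definition nondegenerate_field02 ::
    "('a, 'e::euclidean_space) atlas \<Rightarrow> ('a, 'e) field02 \<Rightarrow> bool" where
  "nondegenerate_field02 A G \<longleftrightarrow>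
     (\<forall>p\<in>points A. \<forall>X\<in>tangent_space A p.
        (\<forall>Y\<in>tangent_space A p. G p X Y = 0) \<longrightarrow> X = (\<lambda>_. 0))"

(* The index: the largest dimension of a subspace of the tangent space on which the form is
   negative definite; subspaces are given by coordinate vectors in the chart c. *)
definition form_index ::
    "('a, 'e::euclidean_space) atlas \<Rightarrow> ('a, 'e) field02 \<Rightarrow> ('a, 'e) chart \<Rightarrow> 'a \<Rightarrow> nat" where
  "form_index A G c p = Max {dim S |S. subspace S \<and>
     (\<forall>v\<in>S. v \<noteq> 0 \<longrightarrow> G p (tvec A c p v) (tvec A c p v) < 0)}"

definition pseudo_riemannian_manifold ::
    "'a topology \<Rightarrow> ('a, 'e::euclidean_space) atlas \<Rightarrow> ('a, 'e) field02 \<Rightarrow> bool" where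
  "pseudo_riemannian_manifold T A G \<longleftrightarrow>
     smooth_manifold T A \<and> smooth_field02 A G \<and> symmetric_field02 A G \<and>
     nondegenerate_field02 A G \<and>
     (\<exists>\<nu>. \<forall>p\<in>points A. \<forall>c\<in>charts_at A p. form_index A G c p = \<nu>)"

definition pullback02 ::
    "('a, 'e::euclidean_space) atlas \<Rightarrow> ('b, 'f::euclidean_space) atlas \<Rightarrow> ('a \<Rightarrow> 'b) \<Rightarrow>
     ('b, 'f) field02 \<Rightarrow> ('a, 'e) field02" where
  "pullback02 A B F G = (\<lambda>p X Y.
     if p \<in> points A \<and> X \<in> tangent_space A p \<and> Y \<in> tangent_space A p
     then G (F p) (tangent_map A B F p X) (tangent_map A B F p Y) else 0)"


section \<open>The slit tangent bundle\<close>

type_synonym ('a, 'e) tpoint = "'a \<times> ('a, 'e) tvector"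

definition tangent_bundle :: "('a, 'e::euclidean_space) atlas \<Rightarrow> ('a, 'e) tpoint set" where
  "tangent_bundle A = {(p, \<xi>). p \<in> points A \<and> \<xi> \<in> tangent_space A p}"

(* The induced coordinates (x, y) on the part of TM over the domain of c. *)
definition tangent_chart ::
    "('a, 'e::euclidean_space) atlas \<Rightarrow> ('a, 'e) chart \<Rightarrow> (('a, 'e) tpoint, 'e \<times> 'e) chart" where
  "tangent_chart A c =
     ({w \<in> tangent_bundle A. fst w \<in> fst c}, \<lambda>(p, \<xi>). (snd c p, \<xi> c))"

definition tangent_topology ::
    "('a, 'e::euclidean_space) atlas \<Rightarrow> ('a, 'e) tpoint topology" where
  "tangent_topology A = topology_generated_by
     {{w \<in> fst (tangent_chart A c). snd (tangent_chart A c) w \<in> N} |c N. c \<in> A \<and> open N}"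

definition slit_bundle :: "('a, 'e::euclidean_space) atlas \<Rightarrow> ('a, 'e) tpoint set" where
  "slit_bundle A = {(p, \<xi>) \<in> tangent_bundle A. \<xi> \<noteq> (\<lambda>_. 0)}"

definition slit_topology ::
    "('a, 'e::euclidean_space) atlas \<Rightarrow> ('a, 'e) tpoint topology" where
  "slit_topology A = subtopology (tangent_topology A) (slit_bundle A)"

definition slit_chart ::
    "('a, 'e::euclidean_space) atlas \<Rightarrow> ('a, 'e) chart \<Rightarrow> (('a, 'e) tpoint, 'e \<times> 'e) chart" where
  "slit_chart A c = (fst (tangent_chart A c) \<inter> slit_bundle A, snd (tangent_chart A c))"

definition slit_atlas ::
    "('a, 'e::euclidean_space) atlas \<Rightarrow> (('a, 'e) tpoint, 'e \<times> 'e) atlas" where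
  "slit_atlas A = slit_chart A ` A"

(* h_t : (x, y) \<mapsto> (x, t y) *)
definition fiber_scaling :: "real \<Rightarrow> ('a, 'e::euclidean_space) tpoint \<Rightarrow> ('a, 'e) tpoint" where
  "fiber_scaling t = (\<lambda>(p, \<xi>). (p, \<lambda>c. t *\<^sub>R \<xi> c))"

definition zero_homogeneous ::
    "('a, 'e::euclidean_space) atlas \<Rightarrow> (('a, 'e) tpoint, 'e \<times> 'e) field02 \<Rightarrow> bool" where
  "zero_homogeneous A G \<longleftrightarrow>
     (\<forall>t>0. pullback02 (slit_atlas A) (slit_atlas A) (fiber_scaling t) G = G)"


section \<open>The 0-homogeneous lift\<close>

(* From here on the model space is real^'n, so that n = CARD('n).  Components are taken in the
   chart c and regarded as functions of the coordinate vector x. *)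
definition metric_comp ::
    "('a, real^'n) atlas \<Rightarrow> ('a, real^'n) field02 \<Rightarrow> ('a, real^'n) chart \<Rightarrow>
     'n \<Rightarrow> 'n \<Rightarrow> real^'n \<Rightarrow> real" where
  "metric_comp A g c i j x = (let p = chart_inv c x in
     g p (tvec A c p (axis i 1)) (tvec A c p (axis j 1)))"

definition partial :: "'n \<Rightarrow> (real^'n \<Rightarrow> real) \<Rightarrow> real^'n \<Rightarrow> real" where
  "partial i f x = frechet_derivative f (at x) (axis i 1)"

(* christoffel A g c i j k is the symbol with lower indices i, j and upper index k:
   1/2 g^{kl} (d_i g_{jl} + d_j g_{il} - d_l g_{ij}). *)
definition christoffel ::
    "('a, real^'n) atlas \<Rightarrow> ('a, real^'n) field02 \<Rightarrow> ('a, real^'n) chart \<Rightarrow>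
     'n \<Rightarrow> 'n \<Rightarrow> 'n \<Rightarrow> real^'n \<Rightarrow> real" where
  "christoffel A g c i j k x = (1 / 2) * (\<Sum>l\<in>UNIV.
     matrix_inv (\<chi> a b. metric_comp A g c a b x) $ k $ l *
     (partial i (metric_comp A g c j l) x + partial j (metric_comp A g c i l) x
        - partial l (metric_comp A g c i j) x))"

(* These functions are the coefficients of the torsion-free connection compatible with g. *)
lemma christoffel_levi_civita:
  fixes g :: "('a, real^'n) field02"
  assumes N: "open N" "x \<in> N"
    and sym: "\<And>z i j. z \<in> N \<Longrightarrow> metric_comp A g c i j z = metric_comp A g c j i z"
    and inv: "invertible (\<chi> a b. metric_comp A g c a b x)"
  shows "christoffel A g c i j k x = christoffel A g c j i k x"
    and "partial k (metric_comp A g c i j) x =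
      (\<Sum>m\<in>UNIV. christoffel A g c k i m x * metric_comp A g c m j x) +
      (\<Sum>m\<in>UNIV. christoffel A g c k j m x * metric_comp A g c i m x)"
proof -
  let ?g = "metric_comp A g c"
  let ?M = "\<chi> a b. ?g a b x"
  have psym: "partial l (?g i j) x = partial l (?g j i) x" for l i j
  proof -
    have "(?g i j has_derivative D) (at x) \<longleftrightarrow> (?g j i has_derivative D) (at x)" for D
      using has_derivative_transform_within_open[OF _ N, of "?g i j" D UNIV "?g j i"]
        has_derivative_transform_within_open[OF _ N, of "?g j i" D UNIV "?g i j"] sym by blast
    then show ?thesis
      by (simp add: partial_def frechet_derivative_def)
  qed
  show "christoffel A g c i j k x = christoffel A g c j i k x"
    by (simp add: christoffel_def psym[of _ i j] add.commute)
  have MI: "?M ** matrix_inv ?M = mat 1"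
    using someI_ex[OF inv[unfolded invertible_def]] by (simp add: matrix_inv_def)
  have MI': "(\<Sum>m\<in>UNIV. ?g j m x * matrix_inv ?M $ m $ l) = (if j = l then 1 else 0)" for j l
    using arg_cong[OF MI, of "\<lambda>M. M $ j $ l"] by (simp add: matrix_matrix_mult_def mat_def)
  have low: "(\<Sum>m\<in>UNIV. christoffel A g c k i m x * ?g j m x) =
      (1/2) * (partial k (?g i j) x + partial i (?g k j) x - partial j (?g k i) x)" for k i j
  proof -
    let ?P = "\<lambda>l. partial k (?g i l) x + partial i (?g k l) x - partial l (?g k i) x"
    have "(\<Sum>m\<in>UNIV. christoffel A g c k i m x * ?g j m x) =
        (\<Sum>m\<in>UNIV. \<Sum>l\<in>UNIV. (1/2) * (?g j m x * matrix_inv ?M $ m $ l) * ?P l)"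
      by (simp add: christoffel_def sum_distrib_left sum_distrib_right mult_ac)
    also have "\<dots> = (\<Sum>l\<in>UNIV. \<Sum>m\<in>UNIV. (1/2) * (?g j m x * matrix_inv ?M $ m $ l) * ?P l)"
      by (rule sum.swap)
    also have "\<dots> = (\<Sum>l\<in>UNIV. (1/2) * (\<Sum>m\<in>UNIV. ?g j m x * matrix_inv ?M $ m $ l) * ?P l)"
      by (simp only: sum_distrib_left sum_distrib_right)
    also have "\<dots> = (\<Sum>l\<in>UNIV. if j = l then (1/2) * ?P l else 0)"
      unfolding MI' by (rule sum.cong) auto
    also have "\<dots> = (1/2) * ?P j" by simp
    finally show ?thesis .
  qed
  have s: "?g m j x = ?g j m x" for m j using sym N by blast
  show "partial k (?g i j) x =
      (\<Sum>m\<in>UNIV. christoffel A g c k i m x * ?g m j x) +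
      (\<Sum>m\<in>UNIV. christoffel A g c k j m x * ?g i m x)"
    unfolding s[of _ j] low
    by (simp add: psym[of _ j i] psym[of _ k i] psym[of _ k j] field_simps)
qed

definition fiber_norm ::
    "('a, real^'n) atlas \<Rightarrow> ('a, real^'n) field02 \<Rightarrow> ('a, real^'n) chart \<Rightarrow>
     ('a, real^'n) tpoint \<Rightarrow> real" where
  "fiber_norm A g c w = (let (x, y) = snd (slit_chart A c) w in
     sqrt (\<Sum>i\<in>UNIV. \<Sum>j\<in>UNIV. metric_comp A g c i j x * y $ i * y $ j))"

definition horizontal_frame ::
    "('a, real^'n) atlas \<Rightarrow> ('a, real^'n) field02 \<Rightarrow> ('a, real^'n) chart \<Rightarrow> 'n \<Rightarrow>
     ('a, real^'n) tpoint \<Rightarrow> (('a, real^'n) tpoint, (real^'n) \<times> (real^'n)) tvector" where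
  "horizontal_frame A g c i w = (let (x, y) = snd (slit_chart A c) w in
     tvec (slit_atlas A) (slit_chart A c) w
       (axis i 1, \<chi> m. - (\<Sum>a\<in>UNIV. y $ a * christoffel A g c a i m x)))"

definition vertical_frame ::
    "('a, real^'n) atlas \<Rightarrow> ('a, real^'n) chart \<Rightarrow> 'n \<Rightarrow>
     ('a, real^'n) tpoint \<Rightarrow> (('a, real^'n) tpoint, (real^'n) \<times> (real^'n)) tvector" where
  "vertical_frame A c i w = tvec (slit_atlas A) (slit_chart A c) w (0, axis i 1)"

definition is_homogeneous_lift ::
    "('a, real^'n) atlas \<Rightarrow> ('a, real^'n) field02 \<Rightarrow>
     (('a, real^'n) tpoint, (real^'n) \<times> (real^'n)) field02 \<Rightarrow> bool" where
  "is_homogeneous_lift A g G \<longleftrightarrow> tensor_field02 (slit_atlas A) G \<and>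
     (\<forall>c\<in>A. \<forall>w\<in>fst (slit_chart A c). \<forall>i j.
        let X = (\<lambda>i. horizontal_frame A g c i w); V = (\<lambda>i. vertical_frame A c i w);
            h = 2 / fiber_norm A g c w * metric_comp A g c i j (snd c (fst w))
        in G w (X i) (X j) = 0 \<and> G w (V i) (V j) = 0 \<and>
           G w (X i) (V j) = h \<and> G w (V j) (X i) = h)"

end

theory Submission
  imports Defs
begin

text \<open>In induced coordinates \<open>(x, y)\<close>, with tangent vectors \<open>(X, X')\<close> and \<open>(Y, Y')\<close>, expanding
  \<open>\<delta>y\<^sup>i\<close> and symmetrizing makes the Christoffel symbols combine into a derivative of the metric:
  the lift is \<open>2 / \<parallel>y\<parallel>\<close> times the complete lift
  \<open>g(X, Y') + g(X', Y) + (\<partial>\<^sub>y g)(X, Y)\<close>. This expression is invariant under coordinate changes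
  \<open>(x, y) \<mapsto> (\<phi>(x), D\<phi>(x) y)\<close>, by differentiating the transformation law of \<open>g\<close> in the direction \<open>y\<close>
  and using the symmetry of \<open>D\<^sup>2\<phi>\<close>; it is visibly smooth and unchanged under
  \<open>(y, X', Y') \<mapsto> (ty, tX', tY')\<close>. Since the adapted frame spans, it is the only field with the
  prescribed values, and \<open>u \<mapsto> u\<^sup>h \<plusminus> u\<^sup>v\<close> parametrizes a positive and a negative definite
  subspace of dimension \<open>n\<close>, so the index is \<open>n\<close> everywhere.\<close>

section \<open>Calculus of smooth functions\<close>

text \<open>Taking the adapted frame itself as the definition of the lift would call for the
  transformation law of the Christoffel symbols and for smoothness of the inverse metric matrix. The
  complete lift contains only \<open>g\<close> and its first derivatives, so the Christoffel symbols
  enter only through the frame at a single point. Smoothness is defined by iterated derivatives in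
  fixed directions, whereas on the tangent bundle the direction \<open>y\<close> is itself a
  coordinate. Hence the recurring expansions over \<open>Basis\<close>, which turn a varying
  direction into fixed directions with smooth coefficients. The characterization of the lift asks
  for no regularity, so uniqueness is linear algebra at each point. Smoothness, symmetry,
  nondegeneracy and homogeneity are proved for the constructed field and pass to every field
  satisfying the characterization because the two are equal.\<close>

lemma differentiable_order_on_cong:
  assumes "open S" "\<And>x. x \<in> S \<Longrightarrow> f x = g x" "differentiable_order_on k S f"
  shows "differentiable_order_on k S g"
  using assms(2,3)
proof (induction k arbitrary: f g)
  case 0
  then show ?case by (simp cong: continuous_on_cong)
next
  case (Suc k)
  have diff: "g differentiable (at x)" if "x \<in> S" for x
    using Suc.prems that assms(1) 
    by (metis differentiable_order_on.simps(2) differentiable_def has_derivative_transform_within_open)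
  have "frechet_derivative f (at x) v = frechet_derivative g (at x) v" if "x \<in> S" for x v
    using frechet_derivative_transform_within_open[of f x S g] Suc.prems that assms(1) by auto
  then show ?case
    using Suc.IH[of "\<lambda>x. frechet_derivative f (at x) v" "\<lambda>x. frechet_derivative g (at x) v" for v]
      Suc.prems(2) diff by auto
qed

lemma smooth_on_cong:
  "open S \<Longrightarrow> (\<And>x. x \<in> S \<Longrightarrow> f x = g x) \<Longrightarrow> smooth_on S f \<Longrightarrow> smooth_on S g"
  unfolding smooth_on_def using differentiable_order_on_cong by blast

lemma differentiable_order_on_mono:
  "differentiable_order_on k S f \<Longrightarrow> R \<subseteq> S \<Longrightarrow> differentiable_order_on k R f"
  by (induction k arbitrary: f) (auto intro: continuous_on_subset)

lemma smooth_on_mono: "smooth_on S f \<Longrightarrow> R \<subseteq> S \<Longrightarrow> smooth_on R f"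
  unfolding smooth_on_def using differentiable_order_on_mono by blast

text \<open>Order \<open>Suc k\<close> does not list order \<open>k\<close> among its clauses. It is
  recovered by induction, starting from the fact that differentiability implies continuity.\<close>

lemma differentiable_order_on_Suc_D:
  "differentiable_order_on (Suc k) S f \<Longrightarrow> differentiable_order_on k S f"
proof (induction k arbitrary: f)
  case 0
  then show ?case
    by (auto intro!: continuous_at_imp_continuous_on differentiable_imp_continuous_within)
next
  case (Suc k)
  then show ?case by (metis differentiable_order_on.simps(2))
qed

text \<open>An introduction rule for an explicitly known derivative \<open>f'\<close>. It spares the
  closure proofs below any reasoning about the chosen value
  \<open>frechet_derivative\<close>.\<close>

lemma differentiable_order_on_SucI:
  assumes "open S" "\<And>x. x \<in> S \<Longrightarrow> (f has_derivative f' x) (at x)"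
    "\<And>v. differentiable_order_on k S (\<lambda>x. f' x v)"
  shows "differentiable_order_on (Suc k) S f"
proof -
  have "f' x v = frechet_derivative f (at x) v" if "x \<in> S" for x v
    using frechet_derivative_at assms(2) that by metis
  then have "differentiable_order_on k S (\<lambda>x. frechet_derivative f (at x) v)" for v
    by (rule differentiable_order_on_cong[OF assms(1) _ assms(3)])
  then show ?thesis
    using assms(2) by (auto simp: differentiable_def)
qed

lemma differentiable_order_on_SucD:
  assumes "differentiable_order_on (Suc k) S f"
  shows "\<And>x. x \<in> S \<Longrightarrow> (f has_derivative frechet_derivative f (at x)) (at x)"
    and "\<And>v. differentiable_order_on k S (\<lambda>x. frechet_derivative f (at x) v)"
    and "differentiable_order_on k S f"
proof -
  show "(f has_derivative frechet_derivative f (at x)) (at x)" if "x \<in> S" for x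
    using assms that by (simp flip: frechet_derivative_works)
  show "differentiable_order_on k S (\<lambda>x. frechet_derivative f (at x) v)" for v
    using assms by simp
  show "differentiable_order_on k S f"
    by (rule differentiable_order_on_Suc_D[OF assms])
qed

lemma smooth_on_has_derivative:
  "smooth_on S f \<Longrightarrow> x \<in> S \<Longrightarrow> (f has_derivative frechet_derivative f (at x)) (at x)"
  using differentiable_order_on_SucD(1) smooth_on_def by blast

lemma smooth_on_frechet_derivative:
  "smooth_on S f \<Longrightarrow> smooth_on S (\<lambda>x. frechet_derivative f (at x) v)"
  using differentiable_order_on_SucD(2) unfolding smooth_on_def by blast

lemma smooth_on_imp_continuous_on: "smooth_on S f \<Longrightarrow> continuous_on S f"
  unfolding smooth_on_def using differentiable_order_on.simps(1) by blast

section \<open>Closure properties of smooth functions\<close>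

lemma differentiable_order_on_const [simp]: "differentiable_order_on k S (\<lambda>x. c)"
  by (induction k arbitrary: c) auto

lemma smooth_on_const [simp]: "smooth_on S (\<lambda>x. c)"
  by (simp add: smooth_on_def)

lemma smooth_on_bounded_linear:
  assumes "open S" "bounded_linear h"
  shows "smooth_on S h"
  unfolding smooth_on_def
proof
  fix k
  have "continuous_on S h" by (simp add: assms(2) linear_continuous_on)
  moreover have "differentiable_order_on (Suc j) S h" for j
    by (rule differentiable_order_on_SucI[where f' = "\<lambda>_. h"])
      (use assms in \<open>auto intro: bounded_linear_imp_has_derivative\<close>)
  ultimately show "differentiable_order_on k S h" by (cases k) auto
qed

lemma differentiable_order_on_add:
  assumes "open S"
  shows "differentiable_order_on k S f \<Longrightarrow> differentiable_order_on k S g \<Longrightarrow>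
    differentiable_order_on k S (\<lambda>x. f x + g x)"
proof (induction k arbitrary: f g)
  case 0
  then show ?case by (auto intro: continuous_intros)
next
  case (Suc k)
  show ?case
    by (rule differentiable_order_on_SucI[OF assms
          has_derivative_add[OF differentiable_order_on_SucD(1)[OF Suc.prems(1)]
            differentiable_order_on_SucD(1)[OF Suc.prems(2)]]])
      (auto intro: Suc.IH differentiable_order_on_SucD(2)[OF Suc.prems(1)]
          differentiable_order_on_SucD(2)[OF Suc.prems(2)])
qed

lemma smooth_on_add:
  "open S \<Longrightarrow> smooth_on S f \<Longrightarrow> smooth_on S g \<Longrightarrow> smooth_on S (\<lambda>x. f x + g x)"
  unfolding smooth_on_def by (simp add: differentiable_order_on_add)

lemma smooth_on_sum:
  assumes "open S" "\<And>i. i \<in> I \<Longrightarrow> smooth_on S (f i)"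
  shows "smooth_on S (\<lambda>x. \<Sum>i\<in>I. f i x)"
  using assms(2)
  by (induction I rule: infinite_finite_induct) (auto intro: smooth_on_add[OF assms(1)])

text \<open>Each Leibniz term pairs a derivative with an undifferentiated factor, so the induction
  uses order \<open>k\<close> both of the derivatives and of \<open>f\<close> and \<open>g\<close>
  themselves.\<close>

lemma (in bounded_bilinear) differentiable_order_on_prod:
  assumes "open S"
  shows "differentiable_order_on k S f \<Longrightarrow> differentiable_order_on k S g \<Longrightarrow>
    differentiable_order_on k S (\<lambda>x. prod (f x) (g x))"
proof (induction k arbitrary: f g)
  case 0
  then show ?case by (auto intro: continuous_on)
next
  case (Suc k)
  show ?case
    by (rule differentiable_order_on_SucI[OF assms
          FDERIV[OF differentiable_order_on_SucD(1)[OF Suc.prems(1)]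
            differentiable_order_on_SucD(1)[OF Suc.prems(2)]]])
      (auto intro!: Suc.IH differentiable_order_on_add assms differentiable_order_on_SucD(2,3)[OF Suc.prems(1)]
          differentiable_order_on_SucD(2,3)[OF Suc.prems(2)])
qed

lemma smooth_on_scaleR:
  "open S \<Longrightarrow> smooth_on S f \<Longrightarrow> smooth_on S g \<Longrightarrow> smooth_on S (\<lambda>x. f x *\<^sub>R g x)"
  unfolding smooth_on_def
  by (simp add: bounded_bilinear.differentiable_order_on_prod[OF bounded_bilinear_scaleR])

lemma smooth_on_mult:
  fixes f g :: "'e::euclidean_space \<Rightarrow> real"
  shows "open S \<Longrightarrow> smooth_on S f \<Longrightarrow> smooth_on S g \<Longrightarrow> smooth_on S (\<lambda>x. f x * g x)"
  using smooth_on_scaleR[of S f g] by simp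

lemma differentiable_order_on_bounded_linear_compose:
  assumes "open S" "bounded_linear h"
  shows "differentiable_order_on k S f \<Longrightarrow> differentiable_order_on k S (\<lambda>x. h (f x))"
proof (induction k arbitrary: f)
  case 0
  then show ?case by (auto intro: bounded_linear.continuous_on[OF assms(2)])
next
  case (Suc k)
  show ?case
    by (rule differentiable_order_on_SucI[OF assms(1)
          bounded_linear.has_derivative[OF assms(2) differentiable_order_on_SucD(1)[OF Suc.prems]]])
      (auto intro: Suc.IH differentiable_order_on_SucD(2)[OF Suc.prems])
qed

lemma smooth_on_bounded_linear_compose:
  "open S \<Longrightarrow> bounded_linear h \<Longrightarrow> smooth_on S f \<Longrightarrow> smooth_on S (\<lambda>x. h (f x))"
  unfolding smooth_on_def by (simp add: differentiable_order_on_bounded_linear_compose)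

lemma smooth_on_Pair:
  assumes "open S" "smooth_on S f" "smooth_on S g"
  shows "smooth_on S (\<lambda>x. (f x, g x))"
proof -
  have "bounded_linear (\<lambda>u. (u, 0))" "bounded_linear (\<lambda>u. (0, u))"
    by (intro bounded_linear_Pair bounded_linear_ident bounded_linear_zero)+
  from smooth_on_add[OF assms(1) smooth_on_bounded_linear_compose[OF assms(1) this(1) assms(2)]
      smooth_on_bounded_linear_compose[OF assms(1) this(2) assms(3)]]
  show ?thesis by simp
qed

text \<open>The derivative of the composite in direction \<open>v\<close> is the derivative of
  \<open>f\<close> in the fixed direction \<open>L v\<close>, again composed with \<open>L\<close>,
  so the induction closes. It serves to view functions of the base point as functions on the tangent
  bundle.\<close>

lemma differentiable_order_on_compose_bounded_linear:
  assumes "open R" "bounded_linear L" "L ` R \<subseteq> S"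
  shows "differentiable_order_on k S f \<Longrightarrow> differentiable_order_on k R (\<lambda>x. f (L x))"
proof (induction k arbitrary: f)
  case 0
  then show ?case
    using assms continuous_on_compose2[of S f R L] by (auto simp: linear_continuous_on)
next
  case (Suc k)
  show ?case
  proof (rule differentiable_order_on_SucI[OF assms(1)])
    fix x assume "x \<in> R"
    then have "L x \<in> S" using assms(3) by auto
    then show "((\<lambda>x. f (L x)) has_derivative (\<lambda>v. frechet_derivative f (at (L x)) (L v))) (at x)"
      using has_derivative_compose[OF bounded_linear_imp_has_derivative[OF assms(2)]
          differentiable_order_on_SucD(1)[OF Suc.prems]] by blast
  qed (rule Suc.IH[OF differentiable_order_on_SucD(2)[OF Suc.prems]])
qed

lemma smooth_on_compose_bounded_linear:
  "open R \<Longrightarrow> bounded_linear L \<Longrightarrow> L ` R \<subseteq> S \<Longrightarrow> smooth_on S f \<Longrightarrow> smooth_on R (\<lambda>x. f (L x))"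
  unfolding smooth_on_def using differentiable_order_on_compose_bounded_linear by blast

text \<open>The exponent varies in the induction because differentiation lowers it by one. The
  application is to exponent \<open>- 1 / 2\<close>, for the factor
  \<open>1 / \<parallel>y\<parallel>\<close>.\<close>

lemma differentiable_order_on_powr:
  fixes f :: "'e::euclidean_space \<Rightarrow> real"
  assumes "open S" "\<And>x. x \<in> S \<Longrightarrow> f x > 0"
  shows "differentiable_order_on k S f \<Longrightarrow> differentiable_order_on k S (\<lambda>x. f x powr a)"
proof (induction k arbitrary: a)
  case 0
  then show ?case using assms(2) by (force intro!: continuous_on_powr)
next
  case (Suc k)
  note D = differentiable_order_on_SucD[OF Suc.prems]
  show ?case
  proof (rule differentiable_order_on_SucI[OF assms(1)])
    fix x assume x: "x \<in> S"
    show "((\<lambda>x. f x powr a) has_derivative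
        (\<lambda>v. a * (f x powr (a - 1) * frechet_derivative f (at x) v))) (at x)"
      by (rule derivative_eq_intros D(1) x assms(2) refl)+
        (use assms(2)[OF x] in \<open>auto simp: powr_diff field_simps\<close>)
  next
    show "differentiable_order_on k S (\<lambda>x. a * (f x powr (a - 1) * frechet_derivative f (at x) v))" for v
      by (intro bounded_bilinear.differentiable_order_on_prod[OF bounded_bilinear_mult] assms(1)
          differentiable_order_on_const Suc.IH D)
  qed
qed

lemma smooth_on_powr:
  fixes f :: "'e::euclidean_space \<Rightarrow> real"
  shows "open S \<Longrightarrow> (\<And>x. x \<in> S \<Longrightarrow> f x > 0) \<Longrightarrow> smooth_on S f \<Longrightarrow> smooth_on S (\<lambda>x. f x powr a)"
  unfolding smooth_on_def by (simp add: differentiable_order_on_powr)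

lemma frechet_derivative_apply:
  "(f has_derivative f') (at x) \<Longrightarrow> frechet_derivative f (at x) v = f' v"
  by (metis frechet_derivative_at)

lemma linear_frechet_derivative_smooth:
  "smooth_on S f \<Longrightarrow> x \<in> S \<Longrightarrow> linear (frechet_derivative f (at x))"
  using smooth_on_has_derivative has_derivative_linear by blast

text \<open>Reduces a value of a linear map, in particular a derivative in a variable direction, to
  its values in finitely many fixed directions.\<close>

lemma linear_expand_Basis:
  assumes "linear h"
  shows "h v = (\<Sum>b\<in>Basis. (v \<bullet> b) *\<^sub>R h b)"
proof -
  have "h v = h (\<Sum>b\<in>Basis. (v \<bullet> b) *\<^sub>R b)" by (simp add: euclidean_representation)
  then show ?thesis using assms by (simp add: linear_sum linear_scale)
qed

subsection \<open>Symmetry of second derivatives\<close>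

text \<open>Two mean value steps: one in direction \<open>u\<close> for the increment of
  \<open>f\<close> by \<open>t *\<^sub>R v\<close>, the other in direction \<open>v\<close> for the
  directional derivative that this produces. The left-hand side is symmetric in \<open>u\<close> and
  \<open>v\<close>, which is what the next lemma exploits.\<close>

lemma second_difference_mvt:
  fixes f :: "'e::euclidean_space \<Rightarrow> real"
  assumes f: "smooth_on S f" and t: "t > 0"
    and box: "\<And>a b. 0 \<le> a \<Longrightarrow> a \<le> t \<Longrightarrow> 0 \<le> b \<Longrightarrow> b \<le> t \<Longrightarrow> x + a *\<^sub>R u + b *\<^sub>R v \<in> S"
  shows "\<exists>a b. 0 \<le> a \<and> a \<le> t \<and> 0 \<le> b \<and> b \<le> t \<and>
    f (x + t *\<^sub>R u + t *\<^sub>R v) - f (x + t *\<^sub>R u) - f (x + t *\<^sub>R v) + f x =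
      t * t * frechet_derivative (\<lambda>z. frechet_derivative f (at z) u) (at (x + a *\<^sub>R u + b *\<^sub>R v)) v"
proof -
  let ?D = "\<lambda>z. frechet_derivative f (at z)"
  let ?h = "\<lambda>a. f (x + a *\<^sub>R u + t *\<^sub>R v) - f (x + a *\<^sub>R u)"
  have d: "((\<lambda>a. f (x + a *\<^sub>R u + b *\<^sub>R v)) has_derivative
      (\<lambda>s. s * ?D (x + a *\<^sub>R u + b *\<^sub>R v) u)) (at a)"
    if "0 \<le> a" "a \<le> t" "0 \<le> b" "b \<le> t" for a b
  proof -
    let ?z = "x + a *\<^sub>R u + b *\<^sub>R v"
    have "((\<lambda>a. f (x + a *\<^sub>R u + b *\<^sub>R v)) has_derivative (\<lambda>s. ?D ?z (s *\<^sub>R u))) (at a)"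
      by (rule has_derivative_compose[of "\<lambda>a. x + a *\<^sub>R u + b *\<^sub>R v",
            OF _ smooth_on_has_derivative[OF f box[OF that]]])
        (auto intro!: derivative_eq_intros)
    then show ?thesis
      by (simp add: linear_scale[OF linear_frechet_derivative_smooth[OF f box[OF that]]])
  qed
  have "\<exists>a\<in>{0<..<t}. ?h t - ?h 0 = (t - 0) * (?D (x + a *\<^sub>R u + t *\<^sub>R v) u - ?D (x + a *\<^sub>R u) u)"
  proof -
    have *: "(?h has_derivative (\<lambda>s. s * (?D (x + a *\<^sub>R u + t *\<^sub>R v) u - ?D (x + a *\<^sub>R u) u))) (at a)"
      if "0 \<le> a" "a \<le> t" for a
      using has_derivative_diff[OF d[of a t] d[of a 0]] that t by (simp add: algebra_simps)
    then have "(?h has_derivative (\<lambda>s. s * (?D (x + a *\<^sub>R u + t *\<^sub>R v) u - ?D (x + a *\<^sub>R u) u)))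
        (at a within {0..t})" if "0 \<le> a" "a \<le> t" for a
      using that has_derivative_at_withinI by blast
    from mvt_simple[OF t this] show ?thesis by auto
  qed
  then obtain a where a: "a \<in> {0<..<t}"
    and ha: "?h t - ?h 0 = t * (?D (x + a *\<^sub>R u + t *\<^sub>R v) u - ?D (x + a *\<^sub>R u) u)" by auto
  have "\<exists>b\<in>{0<..<t}. ?D (x + a *\<^sub>R u + t *\<^sub>R v) u - ?D (x + a *\<^sub>R u + 0 *\<^sub>R v) u =
      (t - 0) * frechet_derivative (\<lambda>z. ?D z u) (at (x + a *\<^sub>R u + b *\<^sub>R v)) v"
  proof -
    have "((\<lambda>b. ?D (x + a *\<^sub>R u + b *\<^sub>R v) u) has_derivative
        (\<lambda>s. s * frechet_derivative (\<lambda>z. ?D z u) (at (x + a *\<^sub>R u + b *\<^sub>R v)) v)) (at b within {0..t})"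
      if "0 \<le> b" "b \<le> t" for b
    proof -
      let ?z = "x + a *\<^sub>R u + b *\<^sub>R v"
      have z: "?z \<in> S" using box a that by auto
      have fu: "smooth_on S (\<lambda>z. ?D z u)" by (rule smooth_on_frechet_derivative[OF f])
      have "((\<lambda>b. ?D (x + a *\<^sub>R u + b *\<^sub>R v) u) has_derivative
          (\<lambda>s. frechet_derivative (\<lambda>z. ?D z u) (at ?z) (s *\<^sub>R v))) (at b)"
        by (rule has_derivative_compose[of "\<lambda>b. x + a *\<^sub>R u + b *\<^sub>R v",
              OF _ smooth_on_has_derivative[OF fu z]])
          (auto intro!: derivative_eq_intros)
      then show ?thesis
        by (simp add: linear_scale[OF linear_frechet_derivative_smooth[OF fu z]]
            has_derivative_at_withinI)
    qed
    from mvt_simple[OF t this] show ?thesis by auto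
  qed
  then obtain b where "b \<in> {0<..<t}" and "?h t - ?h 0 =
      t * t * frechet_derivative (\<lambda>z. ?D z u) (at (x + a *\<^sub>R u + b *\<^sub>R v)) v"
    using ha by auto
  with a show ?thesis by (intro exI[of _ a] exI[of _ b]) auto
qed

text \<open>If the mixed derivatives differed at \<open>x\<close>, some \<open>c\<close> would
  separate them, by continuity on a whole ball. But the second difference of a small parallelogram
  is \<open>t * t\<close> times a value of either one inside that ball.\<close>

lemma second_derivative_symmetric_real:
  fixes f :: "'e::euclidean_space \<Rightarrow> real"
  assumes S: "open S" "x \<in> S" and f: "smooth_on S f"
  shows "frechet_derivative (\<lambda>z. frechet_derivative f (at z) u) (at x) v =
    frechet_derivative (\<lambda>z. frechet_derivative f (at z) v) (at x) u"
proof -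
  let ?H = "\<lambda>u v z. frechet_derivative (\<lambda>z. frechet_derivative f (at z) u) (at z) v"
  have cont: "continuous_on S (?H u v)" for u v
    by (intro smooth_on_imp_continuous_on smooth_on_frechet_derivative f)
  have "\<not> ?H u v x < ?H v u x" for u v
  proof
    assume "?H u v x < ?H v u x"
    then obtain c where c: "?H u v x < c" "c < ?H v u x" using dense by blast
    have o: "open (S \<inter> ?H u v -` {..<c})" "open (S \<inter> ?H v u -` {c<..})"
      by (intro continuous_open_preimage cont S(1) open_lessThan open_greaterThan)+
    have "x \<in> (S \<inter> ?H u v -` {..<c}) \<inter> (S \<inter> ?H v u -` {c<..})" using c S(2) by simp
    then obtain e where e: "e > 0"
      "\<And>z. dist z x < e \<Longrightarrow> z \<in> (S \<inter> ?H u v -` {..<c}) \<inter> (S \<inter> ?H v u -` {c<..})"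
      using open_Int[OF o] unfolding open_dist by meson
    \<comment> \<open>With this scale the parallelogram stays within distance \<open>e / 2\<close>
      of \<open>x\<close>. The summand 1 keeps the denominator positive when \<open>u\<close> and
      \<open>v\<close> both vanish.\<close>
    define t where "t = e / 2 / (norm u + norm v + 1)"
    have n: "norm u + norm v + 1 > 0" by (simp add: add_nonneg_pos)
    have t: "t > 0" using e n by (simp add: t_def)
    have near: "dist (x + a *\<^sub>R u + b *\<^sub>R v) x < e" if "0 \<le> a" "a \<le> t" "0 \<le> b" "b \<le> t" for a b
    proof -
      have "dist (x + a *\<^sub>R u + b *\<^sub>R v) x = norm (a *\<^sub>R u + b *\<^sub>R v)" by (simp add: dist_norm)
      also have "\<dots> \<le> a * norm u + b * norm v"
        using that by (intro norm_triangle_le) auto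
      also have "\<dots> \<le> t * norm u + t * norm v"
        using that by (intro add_mono mult_right_mono) auto
      also have "\<dots> \<le> t * (norm u + norm v + 1)"
        using t by (simp add: algebra_simps)
      also have "\<dots> = e / 2"
        using n unfolding t_def by (intro nonzero_eq_divide_eq[THEN iffD1, OF _ refl]) auto
      finally show ?thesis using e by simp
    qed
    obtain a b where ab: "0 \<le> a" "a \<le> t" "0 \<le> b" "b \<le> t"
      "f (x + t *\<^sub>R u + t *\<^sub>R v) - f (x + t *\<^sub>R u) - f (x + t *\<^sub>R v) + f x =
        t * t * ?H u v (x + a *\<^sub>R u + b *\<^sub>R v)"
      using second_difference_mvt[OF f t, of x u v] near e(2) by blast
    have near': "dist (x + a *\<^sub>R v + b *\<^sub>R u) x < e" if "0 \<le> a" "a \<le> t" "0 \<le> b" "b \<le> t" for a b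
      using near[of b a] that by (simp add: add.commute add.left_commute)
    obtain a' b' where ab': "0 \<le> a'" "a' \<le> t" "0 \<le> b'" "b' \<le> t"
      "f (x + t *\<^sub>R v + t *\<^sub>R u) - f (x + t *\<^sub>R v) - f (x + t *\<^sub>R u) + f x =
        t * t * ?H v u (x + a' *\<^sub>R v + b' *\<^sub>R u)"
      using second_difference_mvt[OF f t, of x v u] near' e(2) by blast
    have "t * t * ?H u v (x + a *\<^sub>R u + b *\<^sub>R v) = t * t * ?H v u (x + a' *\<^sub>R v + b' *\<^sub>R u)"
      using ab(5) ab'(5) by (simp add: algebra_simps)
    then have "?H u v (x + a *\<^sub>R u + b *\<^sub>R v) = ?H v u (x + a' *\<^sub>R v + b' *\<^sub>R u)"
      using t by simp
    moreover have "?H u v (x + a *\<^sub>R u + b *\<^sub>R v) < c" "c < ?H v u (x + a' *\<^sub>R v + b' *\<^sub>R u)"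
      using e(2)[OF near[OF ab(1-4)]] e(2)[OF near'[OF ab'(1-4)]] by auto
    ultimately show False by simp
  qed
  from this[of u v] this[of v u] show ?thesis by simp
qed

text \<open>Taking a component commutes with both derivatives. For the outer derivative the identity
  between inner derivatives has to hold on a neighbourhood, hence on all of
  \<open>S\<close>.\<close>

lemma second_derivative_symmetric:
  fixes f :: "'e::euclidean_space \<Rightarrow> 'f::euclidean_space"
  assumes S: "open S" "x \<in> S" and f: "smooth_on S f"
  shows "frechet_derivative (\<lambda>z. frechet_derivative f (at z) u) (at x) v =
    frechet_derivative (\<lambda>z. frechet_derivative f (at z) v) (at x) u"
proof (rule euclidean_eqI)
  fix b :: 'f assume "b \<in> Basis"
  have fb: "smooth_on S (\<lambda>z. f z \<bullet> b)"
    by (rule smooth_on_bounded_linear_compose[OF S(1) bounded_linear_inner_left f])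
  have inner: "frechet_derivative (\<lambda>z. h z \<bullet> b) (at z) w = frechet_derivative h (at z) w \<bullet> b"
    if "smooth_on S h" "z \<in> S" for h :: "'e \<Rightarrow> 'f" and z w
    using frechet_derivative_at[OF bounded_linear.has_derivative[OF bounded_linear_inner_left
          smooth_on_has_derivative[OF that]], of b] by metis
  have eq: "frechet_derivative (\<lambda>z. frechet_derivative f (at z) u) (at x) v \<bullet> b =
      frechet_derivative (\<lambda>z. frechet_derivative (\<lambda>z. f z \<bullet> b) (at z) u) (at x) v" for u v
  proof -
    have fu: "smooth_on S (\<lambda>z. frechet_derivative f (at z) u)"
      by (rule smooth_on_frechet_derivative[OF f])
    have "frechet_derivative (\<lambda>z. frechet_derivative f (at z) u \<bullet> b) (at x) =
        frechet_derivative (\<lambda>z. frechet_derivative (\<lambda>z. f z \<bullet> b) (at z) u) (at x)"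
    proof (rule frechet_derivative_transform_within_open[OF _ S])
      show "(\<lambda>z. frechet_derivative f (at z) u \<bullet> b) differentiable at x"
        using bounded_linear.has_derivative[OF bounded_linear_inner_left
            smooth_on_has_derivative[OF fu S(2)]] differentiable_def by blast
    qed (simp add: inner[OF f])
    then show ?thesis using inner[OF fu S(2)] by simp
  qed
  show "frechet_derivative (\<lambda>z. frechet_derivative f (at z) u) (at x) v \<bullet> b =
      frechet_derivative (\<lambda>z. frechet_derivative f (at z) v) (at x) u \<bullet> b"
    unfolding eq by (rule second_derivative_symmetric_real[OF S fb])
qed

section \<open>Tangent spaces in coordinates\<close>

abbreviation jacobian ::
    "('a, 'e::euclidean_space) chart \<Rightarrow> ('a, 'e) chart \<Rightarrow> 'a \<Rightarrow> 'e \<Rightarrow> 'e" where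
  "jacobian c d p \<equiv> frechet_derivative (snd d \<circ> chart_inv c) (at (snd c p))"

text \<open>The part of the manifold structure that does not mention the topology of the underlying
  space. It is instantiated both with \<open>A\<close> and with \<open>slit_atlas A\<close>, so that
  tangent vectors of the slit bundle can be handled before its topology is studied.\<close>

locale smooth_atlas =
  fixes A :: "('a, 'e::euclidean_space) atlas"
  assumes inj: "c \<in> A \<Longrightarrow> inj_on (snd c) (fst c)"
    and open_chart_image: "c \<in> A \<Longrightarrow> open (chart_image c)"
    and open_overlap: "c \<in> A \<Longrightarrow> d \<in> A \<Longrightarrow> open (snd c ` (fst c \<inter> fst d))"
    and smooth_transition: "c \<in> A \<Longrightarrow> d \<in> A \<Longrightarrow>
      smooth_on (snd c ` (fst c \<inter> fst d)) (snd d \<circ> chart_inv c)"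
begin

lemma chart_inv_snd: "c \<in> A \<Longrightarrow> p \<in> fst c \<Longrightarrow> chart_inv c (snd c p) = p"
  by (simp add: chart_inv_def inj)

lemma transition_snd: "c \<in> A \<Longrightarrow> p \<in> fst c \<Longrightarrow> (snd d \<circ> chart_inv c) (snd c p) = snd d p"
  by (simp add: chart_inv_snd)

lemma chart_inv_in: "x \<in> chart_image c \<Longrightarrow> chart_inv c x \<in> fst c"
  by (simp add: chart_image_def chart_inv_def inv_into_into)

lemma snd_chart_inv: "x \<in> chart_image c \<Longrightarrow> snd c (chart_inv c x) = x"
  by (simp add: chart_image_def chart_inv_def f_inv_into_f)

lemma overlap_iff:
  assumes "c \<in> A"
  shows "x \<in> snd c ` (fst c \<inter> U) \<longleftrightarrow> x \<in> chart_image c \<and> chart_inv c x \<in> U"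
  using chart_inv_in[of x c] snd_chart_inv[of x c] chart_inv_snd[OF assms]
  by (auto simp: chart_image_def)

lemma transition_has_derivative:
  assumes "c \<in> A" "d \<in> A" "p \<in> fst c" "p \<in> fst d"
  shows "((snd d \<circ> chart_inv c) has_derivative jacobian c d p) (at (snd c p))"
  using smooth_on_has_derivative[OF smooth_transition[OF assms(1,2)]] assms(3,4) by blast

lemma linear_jacobian:
  "c \<in> A \<Longrightarrow> d \<in> A \<Longrightarrow> p \<in> fst c \<Longrightarrow> p \<in> fst d \<Longrightarrow> linear (jacobian c d p)"
  using transition_has_derivative has_derivative_linear by blast

lemma jacobian_refl:
  assumes "c \<in> A" "p \<in> fst c"
  shows "jacobian c c p v = v"
proof -
  have "frechet_derivative (\<lambda>x. x) (at (snd c p)) = jacobian c c p"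
    by (rule frechet_derivative_transform_within_open[OF _ open_chart_image[OF assms(1)]])
      (use assms in \<open>auto simp: snd_chart_inv chart_image_def\<close>)
  then show ?thesis by (metis frechet_derivative_ident)
qed

lemma jacobian_chain:
  assumes A: "c \<in> A" "d \<in> A" "e \<in> A" and p: "p \<in> fst c" "p \<in> fst d" "p \<in> fst e"
  shows "jacobian d e p (jacobian c d p v) = jacobian c e p v"
proof -
  \<comment> \<open>The composite through \<open>d\<close> equals the direct transition only over
    the triple overlap; its image is open, so the derivatives at \<open>snd c p\<close>
    agree.\<close>
  let ?N = "snd c ` (fst c \<inter> fst d) \<inter> snd c ` (fst c \<inter> fst e)"
  have "((\<lambda>x. (snd e \<circ> chart_inv d) ((snd d \<circ> chart_inv c) x)) has_derivative
      (\<lambda>v. jacobian d e p (jacobian c d p v))) (at (snd c p))"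
    using transition_has_derivative[OF A(2,3) p(2,3)]
    by (intro has_derivative_compose[OF transition_has_derivative[OF A(1,2) p(1,2)]])
      (simp only: transition_snd[OF A(1) p(1)])
  then have "((snd e \<circ> chart_inv c) has_derivative
      (\<lambda>v. jacobian d e p (jacobian c d p v))) (at (snd c p))"
  proof (rule has_derivative_transform_within_open)
    show "open ?N" using open_overlap A by blast
    show "snd c p \<in> ?N" using p by blast
    show "(snd e \<circ> chart_inv d) ((snd d \<circ> chart_inv c) x) = (snd e \<circ> chart_inv c) x"
      if "x \<in> ?N" for x
      using that A by (simp add: overlap_iff chart_inv_snd)
  qed
  then show ?thesis using frechet_derivative_at by metis
qed

lemma charts_at_iff: "c \<in> charts_at A p \<longleftrightarrow> c \<in> A \<and> p \<in> fst c"
  by (simp add: charts_at_def)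

lemma tvec_chart: "c \<in> charts_at A p \<Longrightarrow> tvec A c p v c = v"
  by (simp add: tvec_def jacobian_refl charts_at_iff)

text \<open>The chain rule for transition maps is exactly the compatibility demanded of the
  components.\<close>

lemma tvec_in_tangent_space:
  assumes "c \<in> charts_at A p"
  shows "tvec A c p v \<in> tangent_space A p"
  unfolding tangent_space_def mem_Collect_eq
proof (intro conjI allI impI ballI)
  fix d e assume d: "d \<in> charts_at A p" and e: "e \<in> charts_at A p"
  have "jacobian d e p (jacobian c d p v) = jacobian c e p v"
    using assms d e by (intro jacobian_chain) (simp_all only: charts_at_iff)
  then show "tvec A c p v e = jacobian d e p (tvec A c p v d)"
    by (simp only: tvec_def d e if_True)
qed (simp add: tvec_def)

lemma tangent_space_change:
  assumes "\<xi> \<in> tangent_space A p" "c \<in> charts_at A p" "d \<in> charts_at A p"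
  shows "\<xi> d = jacobian c d p (\<xi> c)"
  using assms unfolding tangent_space_def by blast

text \<open>One component determines a tangent vector: compatibility gives its components in the
  other charts at \<open>p\<close>, and the normalization gives 0 elsewhere. With
  \<open>tvec_chart\<close>, each chart thus identifies the tangent space with the model
  space.\<close>

lemma tangent_space_tvec:
  assumes "c \<in> charts_at A p" "\<xi> \<in> tangent_space A p"
  shows "tvec A c p (\<xi> c) = \<xi>"
proof
  fix d
  show "tvec A c p (\<xi> c) d = \<xi> d"
  proof (cases "d \<in> charts_at A p")
    case True
    then show ?thesis using tangent_space_change[OF assms(2,1)] by (simp only: tvec_def if_True)
  next
    case False
    then have "\<xi> d = 0" using assms(2) unfolding tangent_space_def by blast
    then show ?thesis by (simp only: tvec_def False if_False)
  qed
qed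

lemma tvec_change:
  assumes "c \<in> charts_at A p" "d \<in> charts_at A p"
  shows "tvec A d p (jacobian c d p v) = tvec A c p v"
proof -
  have "tvec A c p v d = jacobian c d p v" using assms by (simp add: tvec_def)
  then show ?thesis
    using tangent_space_tvec[OF assms(2) tvec_in_tangent_space[OF assms(1)]] by metis
qed

lemma tvec_lincomb:
  assumes "c \<in> charts_at A p"
  shows "tvec A c p (a *\<^sub>R u + b *\<^sub>R v) = (\<lambda>d. a *\<^sub>R tvec A c p u d + b *\<^sub>R tvec A c p v d)"
proof
  fix d
  show "tvec A c p (a *\<^sub>R u + b *\<^sub>R v) d = a *\<^sub>R tvec A c p u d + b *\<^sub>R tvec A c p v d"
  proof (cases "d \<in> charts_at A p")
    case True
    then have "linear (jacobian c d p)" using assms by (auto simp: charts_at_iff intro: linear_jacobian)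
    then show ?thesis using True by (simp add: tvec_def linear_add linear_scale)
  qed (simp add: tvec_def)
qed

lemma tangent_space_lincomb:
  assumes "X \<in> tangent_space A p" "Y \<in> tangent_space A p"
  shows "(\<lambda>c. a *\<^sub>R X c + b *\<^sub>R Y c) \<in> tangent_space A p"
proof (cases "charts_at A p = {}")
  case True
  then show ?thesis using assms by (simp add: tangent_space_def)
next
  case False
  then obtain c where c: "c \<in> charts_at A p" by blast
  have "tvec A c p (a *\<^sub>R X c + b *\<^sub>R Y c) \<in> tangent_space A p"
    by (rule tvec_in_tangent_space[OF c])
  then show ?thesis
    unfolding tvec_lincomb[OF c] tangent_space_tvec[OF c assms(1)] tangent_space_tvec[OF c assms(2)] .
qed

lemma tvec_zero: "c \<in> charts_at A p \<Longrightarrow> tvec A c p 0 = (\<lambda>_. 0)"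
  using tvec_lincomb[of c p 0 0 0 0] by simp

lemma tangent_space_eq_zero_iff:
  assumes "c \<in> charts_at A p" "\<xi> \<in> tangent_space A p"
  shows "\<xi> = (\<lambda>_. 0) \<longleftrightarrow> \<xi> c = 0"
  using tvec_zero[OF assms(1)] tangent_space_tvec[OF assms] by metis

lemma tvec_eq_zero_iff: "c \<in> charts_at A p \<Longrightarrow> tvec A c p v = (\<lambda>_. 0) \<longleftrightarrow> v = 0"
  by (simp add: tangent_space_eq_zero_iff tvec_in_tangent_space tvec_chart)

lemma points_iff: "p \<in> points A \<longleftrightarrow> (\<exists>c. c \<in> charts_at A p)"
  unfolding points_def charts_at_iff by blast

lemma field02_linear:
  assumes G: "tensor_field02 A G" and c: "c \<in> charts_at A p" and X: "X \<in> tangent_space A p"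
  shows "linear (\<lambda>v. G p X (tvec A c p v))" "linear (\<lambda>v. G p (tvec A c p v) X)"
proof -
  have B: "bilinear_form_on (tangent_space A p) (G p)"
    using G c points_iff unfolding tensor_field02_def by blast
  note t = tvec_in_tangent_space[OF c]
  have 1: "G p X (tvec A c p (a *\<^sub>R u + b *\<^sub>R v)) = a * G p X (tvec A c p u) + b * G p X (tvec A c p v)"
    and 2: "G p (tvec A c p (a *\<^sub>R u + b *\<^sub>R v)) X = a * G p (tvec A c p u) X + b * G p (tvec A c p v) X"
    for a b u v
    unfolding tvec_lincomb[OF c] using B t X unfolding bilinear_form_on_def by blast+
  show "linear (\<lambda>v. G p X (tvec A c p v))"
    using 1[of 1 _ 1] 1[of _ _ 0 0] by (intro linearI) simp_all
  show "linear (\<lambda>v. G p (tvec A c p v) X)"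
    using 2[of 1 _ 1] 2[of _ _ 0 0] by (intro linearI) simp_all
qed

lemma field02_bilinear:
  assumes "tensor_field02 A G" "c \<in> charts_at A p"
  shows "bilinear (\<lambda>u v. G p (tvec A c p u) (tvec A c p v))"
  unfolding bilinear_def using field02_linear[OF assms] tvec_in_tangent_space[OF assms(2)] by blast

end

lemma smooth_manifold_atlas:
  assumes "smooth_manifold T A"
  shows "smooth_atlas A"
proof
  fix c d assume c: "c \<in> A"
  then have T: "openin T (fst c)" "open (chart_image c)"
    and h: "homeomorphic_map (subtopology T (fst c)) (top_of_set (chart_image c)) (snd c)"
    using assms by (auto simp: smooth_manifold_def)
  have top: "topspace (subtopology T (fst c)) = fst c"
    using T(1) openin_subset by fastforce
  show "inj_on (snd c) (fst c)"
    using homeomorphic_imp_injective_map[OF h] top by simp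
  show "open (chart_image c)" by fact
  assume d: "d \<in> A"
  then have "openin (subtopology T (fst c)) (fst c \<inter> fst d)"
    using assms by (auto simp: smooth_manifold_def openin_subtopology_Int2)
  then have "openin (top_of_set (chart_image c)) (snd c ` (fst c \<inter> fst d))"
    using homeomorphic_imp_open_map[OF h] by (auto simp: open_map_def)
  then show "open (snd c ` (fst c \<inter> fst d))"
    using T(2) openin_open_trans by blast
  show "smooth_on (snd c ` (fst c \<inter> fst d)) (snd d \<circ> chart_inv c)"
    using assms c d by (auto simp: smooth_manifold_def)
qed

section \<open>The slit tangent bundle as a manifold\<close>

text \<open>The tangent map in coordinates. Applied to a transition map of \<open>A\<close>, it is
  the corresponding change of induced coordinates.\<close>

definition tangent_lift ::
    "('e::euclidean_space \<Rightarrow> 'f::euclidean_space) \<Rightarrow> 'e \<times> 'e \<Rightarrow> 'f \<times> 'f" where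
  "tangent_lift f z = (f (fst z), frechet_derivative f (at (fst z)) (snd z))"

lemma smooth_on_fst: "open S \<Longrightarrow> smooth_on S f \<Longrightarrow> smooth_on (S \<times> UNIV) (\<lambda>z. f (fst z))"
  by (rule smooth_on_compose_bounded_linear[OF _ bounded_linear_fst]) (auto intro: open_Times)

lemma smooth_on_snd_inner: "open S \<Longrightarrow> smooth_on S (\<lambda>z::'e::euclidean_space \<times> 'e. snd z \<bullet> b)"
  by (intro smooth_on_bounded_linear bounded_linear_inner_left_comp bounded_linear_snd)

lemma smooth_on_frechet_derivative_snd:
  fixes f :: "'e::euclidean_space \<Rightarrow> 'f::euclidean_space"
  assumes S: "open S" and f: "smooth_on S f"
  shows "smooth_on (S \<times> UNIV) (\<lambda>z. frechet_derivative f (at (fst z)) (snd z))"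
proof (rule smooth_on_cong)
  show op: "open (S \<times> (UNIV :: 'e set))" by (simp add: open_Times S)
  show "smooth_on (S \<times> UNIV)
      (\<lambda>z. \<Sum>b\<in>Basis. (snd z \<bullet> b) *\<^sub>R frechet_derivative f (at (fst z)) b)"
    by (intro smooth_on_sum smooth_on_scaleR op smooth_on_snd_inner
        smooth_on_fst[OF S smooth_on_frechet_derivative[OF f]])
  show "(\<Sum>b\<in>Basis. (snd z \<bullet> b) *\<^sub>R frechet_derivative f (at (fst z)) b) =
      frechet_derivative f (at (fst z)) (snd z)" if "z \<in> S \<times> UNIV" for z
    by (rule linear_expand_Basis[symmetric], rule linear_frechet_derivative_smooth[OF f])
      (use that in auto)
qed

lemma smooth_on_tangent_lift:
  fixes f :: "'e::euclidean_space \<Rightarrow> 'f::euclidean_space"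
  assumes "open S" "smooth_on S f"
  shows "smooth_on (S \<times> UNIV) (tangent_lift f)"
  unfolding tangent_lift_def[abs_def]
  by (intro smooth_on_Pair smooth_on_fst smooth_on_frechet_derivative_snd assms open_Times open_UNIV)

text \<open>Differentiation in the base point produces the second derivative of \<open>f\<close>,
  and differentiation in the direction, which enters linearly, produces \<open>Df\<close> itself.
  The computation runs over \<open>Basis\<close> so that only derivatives of \<open>f\<close> in
  fixed directions are differentiated.\<close>

lemma frechet_derivative_direction_has_derivative:
  fixes f :: "'e::euclidean_space \<Rightarrow> 'f::euclidean_space"
  assumes S: "open S" "x \<in> S" and f: "smooth_on S f"
  shows "((\<lambda>z. frechet_derivative f (at (fst z)) (snd z)) has_derivative
    (\<lambda>w. frechet_derivative (\<lambda>z. frechet_derivative f (at z) y) (at x) (fst w) +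
         frechet_derivative f (at x) (snd w))) (at (x, y))"
proof -
  let ?D = "\<lambda>z. frechet_derivative f (at z)"
  let ?D2 = "\<lambda>v. frechet_derivative (\<lambda>z. ?D z v) (at x)"
  have lin: "linear (?D z)" if "z \<in> S" for z
    by (rule linear_frechet_derivative_smooth[OF f that])
  have D2: "((\<lambda>z. ?D z v) has_derivative ?D2 v) (at x)" for v
    by (rule smooth_on_has_derivative[OF smooth_on_frechet_derivative[OF f] S(2)])
  have D2fst: "((\<lambda>z. ?D (fst z) v) has_derivative (\<lambda>w. ?D2 v (fst w))) (at (x, y))" for v
    by (rule has_derivative_compose[of fst, OF has_derivative_fst[OF has_derivative_ident]])
      (simp add: D2)
  have "((\<lambda>z. \<Sum>b\<in>Basis. (snd z \<bullet> b) *\<^sub>R ?D (fst z) b) has_derivative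
      (\<lambda>w. \<Sum>b\<in>Basis. (y \<bullet> b) *\<^sub>R ?D2 b (fst w) + (snd w \<bullet> b) *\<^sub>R ?D x b)) (at (x, y))"
  proof (rule has_derivative_sum)
    fix b :: 'e
    have "((\<lambda>z. snd z \<bullet> b) has_derivative (\<lambda>w. snd w \<bullet> b)) (at (x, y))"
      by (intro has_derivative_inner_left has_derivative_snd has_derivative_ident)
    from has_derivative_scaleR[OF this D2fst[of b]]
    show "((\<lambda>z. (snd z \<bullet> b) *\<^sub>R ?D (fst z) b) has_derivative
        (\<lambda>w. (y \<bullet> b) *\<^sub>R ?D2 b (fst w) + (snd w \<bullet> b) *\<^sub>R ?D x b)) (at (x, y))"
      by simp
  qed
  then have derivative: "((\<lambda>z. ?D (fst z) (snd z)) has_derivative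
      (\<lambda>w. \<Sum>b\<in>Basis. (y \<bullet> b) *\<^sub>R ?D2 b (fst w) + (snd w \<bullet> b) *\<^sub>R ?D x b)) (at (x, y))"
  proof (rule has_derivative_transform_within_open)
    show "open (S \<times> (UNIV :: 'e set))" by (simp add: open_Times S)
    show "(x, y) \<in> S \<times> UNIV" using S by simp
    show "(\<Sum>b\<in>Basis. (snd z \<bullet> b) *\<^sub>R ?D (fst z) b) = ?D (fst z) (snd z)" if "z \<in> S \<times> UNIV" for z
      by (rule linear_expand_Basis[symmetric]) (use lin that in auto)
  qed
  \<comment> \<open>Linearity in the inner direction: near \<open>x\<close> the derivative in
    direction \<open>y\<close> is a combination of those in basis directions with constant
    coefficients, and this combination is differentiated.\<close>
  have "?D2 y v = (\<Sum>b\<in>Basis. (y \<bullet> b) *\<^sub>R ?D2 b v)" for v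
  proof -
    have "((\<lambda>z. \<Sum>b\<in>Basis. (y \<bullet> b) *\<^sub>R ?D z b) has_derivative
        (\<lambda>v. \<Sum>b\<in>Basis. (y \<bullet> b) *\<^sub>R ?D2 b v)) (at x)"
      by (intro has_derivative_sum has_derivative_scaleR_right D2)
    then have "((\<lambda>z. ?D z y) has_derivative (\<lambda>v. \<Sum>b\<in>Basis. (y \<bullet> b) *\<^sub>R ?D2 b v)) (at x)"
    proof (rule has_derivative_transform_within_open[OF _ S])
      show "(\<Sum>b\<in>Basis. (y \<bullet> b) *\<^sub>R ?D z b) = ?D z y" if "z \<in> S" for z
        by (rule linear_expand_Basis[symmetric]) (rule lin[OF that])
    qed
    then show ?thesis by (rule frechet_derivative_apply)
  qed
  moreover have "?D x v = (\<Sum>b\<in>Basis. (v \<bullet> b) *\<^sub>R ?D x b)" for v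
    by (rule linear_expand_Basis[OF lin[OF S(2)]])
  ultimately have "?D2 y (fst w) + ?D x (snd w) =
      (\<Sum>b\<in>Basis. (y \<bullet> b) *\<^sub>R ?D2 b (fst w) + (snd w \<bullet> b) *\<^sub>R ?D x b)" for w
    unfolding sum.distrib by (rule arg_cong2[of _ _ _ _ "(+)"])
  then have "(\<lambda>w. ?D2 y (fst w) + ?D x (snd w)) =
      (\<lambda>w. \<Sum>b\<in>Basis. (y \<bullet> b) *\<^sub>R ?D2 b (fst w) + (snd w \<bullet> b) *\<^sub>R ?D x b)"
    by (rule ext)
  with derivative show ?thesis by (rule ssubst[rotated])
qed

lemma tangent_lift_has_derivative:
  fixes f :: "'e::euclidean_space \<Rightarrow> 'f::euclidean_space"
  assumes S: "open S" "x \<in> S" and f: "smooth_on S f"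
  shows "(tangent_lift f has_derivative
    (\<lambda>w. (frechet_derivative f (at x) (fst w),
         frechet_derivative (\<lambda>z. frechet_derivative f (at z) y) (at x) (fst w) +
         frechet_derivative f (at x) (snd w)))) (at (x, y))"
proof -
  have "((\<lambda>z. f (fst z)) has_derivative (\<lambda>w. frechet_derivative f (at x) (fst w))) (at (x, y))"
    by (rule has_derivative_compose[of fst, OF has_derivative_fst[OF has_derivative_ident]])
      (simp add: smooth_on_has_derivative[OF f S(2)])
  then show ?thesis
    unfolding tangent_lift_def[abs_def]
    by (rule has_derivative_Pair[OF _ frechet_derivative_direction_has_derivative[OF S f]])
qed

section \<open>Charts, transition maps and Jacobians of the slit bundle\<close>

context smooth_atlas
begin

lemma in_slit_bundle:
  "w \<in> slit_bundle A \<longleftrightarrow>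
    fst w \<in> points A \<and> snd w \<in> tangent_space A (fst w) \<and> snd w \<noteq> (\<lambda>_. 0)"
  by (cases w) (simp add: slit_bundle_def tangent_bundle_def)

lemma in_slit_chart:
  "c \<in> A \<Longrightarrow> w \<in> fst (slit_chart A c) \<longleftrightarrow> w \<in> slit_bundle A \<and> fst w \<in> fst c"
  by (auto simp: slit_chart_def tangent_chart_def slit_bundle_def)

lemma slit_chart_apply [simp]: "snd (slit_chart A c) w = (snd c (fst w), snd w c)"
  by (simp add: slit_chart_def tangent_chart_def split_beta)

lemma charts_at_slit_bundle:
  "w \<in> slit_bundle A \<Longrightarrow> \<exists>c\<in>A. fst w \<in> fst c"
  unfolding in_slit_bundle points_iff charts_at_iff by blast

text \<open>A tangent vector vanishes as soon as one of its components at a chart around the point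
  does. The slit bundle is therefore given by \<open>y \<noteq> 0\<close> in every chart.\<close>

lemma slit_chart_coordinate_nonzero:
  assumes "c \<in> A" "w \<in> fst (slit_chart A c)"
  shows "snd w c \<noteq> 0"
  using assms tangent_space_eq_zero_iff[of c "fst w" "snd w"]
  by (simp add: in_slit_chart in_slit_bundle charts_at_iff)

lemma slit_point:
  assumes c: "c \<in> A" and x: "x \<in> chart_image c" and y: "y \<noteq> 0"
  defines "w \<equiv> (chart_inv c x, tvec A c (chart_inv c x) y)"
  shows "w \<in> fst (slit_chart A c)" "snd (slit_chart A c) w = (x, y)"
proof -
  have p: "c \<in> charts_at A (chart_inv c x)" using chart_inv_in[OF x] c by (simp add: charts_at_iff)
  have "chart_inv c x \<in> points A" using p points_iff by blast
  then show "w \<in> fst (slit_chart A c)"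
    unfolding in_slit_chart[OF c] in_slit_bundle
    using p y by (simp add: w_def tvec_in_tangent_space tvec_eq_zero_iff chart_inv_in[OF x])
  show "snd (slit_chart A c) w = (x, y)"
    using p by (simp add: w_def snd_chart_inv[OF x] tvec_chart)
qed

lemma inj_slit_chart:
  assumes c: "c \<in> A"
  shows "inj_on (snd (slit_chart A c)) (fst (slit_chart A c))"
proof (rule inj_onI)
  fix v w assume v: "v \<in> fst (slit_chart A c)" and w: "w \<in> fst (slit_chart A c)"
    and eq: "snd (slit_chart A c) v = snd (slit_chart A c) w"
  have p: "fst v = fst w"
    using eq v w inj_onD[OF inj[OF c]] by (auto simp: in_slit_chart[OF c])
  have tv: "tvec A c (fst u) (snd u c) = snd u" if "u \<in> fst (slit_chart A c)" for u
    using that c unfolding in_slit_chart[OF c] in_slit_bundle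
    by (intro tangent_space_tvec) (simp_all add: charts_at_iff)
  have "snd v c = snd w c" using eq by simp
  then have "snd v = snd w" using tv[OF v] tv[OF w] p by metis
  with p show "v = w" by (rule prod_eqI)
qed

lemma slit_chart_inv:
  assumes "c \<in> A" "x \<in> chart_image c" "y \<noteq> 0"
  shows "chart_inv (slit_chart A c) (x, y) = (chart_inv c x, tvec A c (chart_inv c x) y)"
  using slit_point[OF assms] inj_slit_chart[OF assms(1)]
  unfolding chart_inv_def by (metis inv_into_f_f)

lemma slit_overlap:
  assumes c: "c \<in> A" and d: "d \<in> A"
  shows "snd (slit_chart A c) ` (fst (slit_chart A c) \<inter> fst (slit_chart A d)) =
    snd c ` (fst c \<inter> fst d) \<times> (- {0})"
proof (intro equalityI subsetI)
  fix z assume "z \<in> snd (slit_chart A c) ` (fst (slit_chart A c) \<inter> fst (slit_chart A d))"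
  then show "z \<in> snd c ` (fst c \<inter> fst d) \<times> (- {0})"
    using slit_chart_coordinate_nonzero[OF c] c d by (auto simp: in_slit_chart)
next
  fix z :: "'e \<times> 'e" assume z: "z \<in> snd c ` (fst c \<inter> fst d) \<times> (- {0})"
  then have x: "fst z \<in> chart_image c" "chart_inv c (fst z) \<in> fst d" and y: "snd z \<noteq> 0"
    unfolding mem_Times_iff overlap_iff[OF c] by auto
  define w where "w = (chart_inv c (fst z), tvec A c (chart_inv c (fst z)) (snd z))"
  have w: "w \<in> fst (slit_chart A c)" "snd (slit_chart A c) w = z"
    using slit_point[OF c x(1) y] by (simp_all only: w_def prod.collapse)
  moreover have "w \<in> fst (slit_chart A d)"
    using w(1) x(2) unfolding in_slit_chart[OF c] in_slit_chart[OF d] by (simp add: w_def)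
  ultimately show "z \<in> snd (slit_chart A c) ` (fst (slit_chart A c) \<inter> fst (slit_chart A d))"
    by blast
qed

lemma slit_chart_image: "c \<in> A \<Longrightarrow> chart_image (slit_chart A c) = chart_image c \<times> (- {0})"
  using slit_overlap[of c c] by (simp add: chart_image_def)

lemma open_slit_overlap:
  "c \<in> A \<Longrightarrow> d \<in> A \<Longrightarrow>
    open (snd (slit_chart A c) ` (fst (slit_chart A c) \<inter> fst (slit_chart A d)))"
  unfolding slit_overlap by (intro open_Times open_overlap) auto

lemma slit_transition:
  assumes c: "c \<in> A" and d: "d \<in> A" and z: "z \<in> snd c ` (fst c \<inter> fst d) \<times> (- {0})"
  shows "(snd (slit_chart A d) \<circ> chart_inv (slit_chart A c)) z =
    tangent_lift (snd d \<circ> chart_inv c) z"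
proof -
  have x: "fst z \<in> chart_image c" "chart_inv c (fst z) \<in> fst d" and y: "snd z \<noteq> 0"
    using z unfolding mem_Times_iff overlap_iff[OF c] by auto
  have "chart_inv (slit_chart A c) z =
      (chart_inv c (fst z), tvec A c (chart_inv c (fst z)) (snd z))"
    using slit_chart_inv[OF c x(1) y] by simp
  then show ?thesis
    using x d by (simp add: tangent_lift_def tvec_def charts_at_iff snd_chart_inv o_def)
qed

lemma smooth_slit_transition:
  assumes "c \<in> A" "d \<in> A"
  shows "smooth_on (snd c ` (fst c \<inter> fst d) \<times> (- {0}))
    (snd (slit_chart A d) \<circ> chart_inv (slit_chart A c))"
proof (rule smooth_on_cong)
  show "open (snd c ` (fst c \<inter> fst d) \<times> (- {0 :: 'e}))"
    using assms by (intro open_Times open_overlap) auto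
  show "smooth_on (snd c ` (fst c \<inter> fst d) \<times> (- {0 :: 'e})) (tangent_lift (snd d \<circ> chart_inv c))"
    by (rule smooth_on_mono[OF smooth_on_tangent_lift[OF open_overlap smooth_transition]])
      (use assms in auto)
qed (use slit_transition[OF assms] in simp)

lemma smooth_atlas_slit: "smooth_atlas (slit_atlas A)"
proof
  fix c assume "c \<in> slit_atlas A"
  then obtain c' where c': "c' \<in> A" "c = slit_chart A c'" by (auto simp: slit_atlas_def)
  show "inj_on (snd c) (fst c)" using inj_slit_chart c' by simp
  show "open (chart_image c)"
    unfolding c'(2) slit_chart_image[OF c'(1)]
    by (intro open_Times open_chart_image c'(1)) auto
  fix d assume "d \<in> slit_atlas A"
  then obtain d' where d': "d' \<in> A" "d = slit_chart A d'" by (auto simp: slit_atlas_def)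
  show "open (snd c ` (fst c \<inter> fst d))" using open_slit_overlap c' d' by simp
  show "smooth_on (snd c ` (fst c \<inter> fst d)) (snd d \<circ> chart_inv c)"
    unfolding c'(2) d'(2) slit_overlap[OF c'(1) d'(1)]
    by (rule smooth_slit_transition[OF c'(1) d'(1)])
qed

lemma charts_at_slit_iff:
  "C \<in> charts_at (slit_atlas A) w \<longleftrightarrow> (\<exists>c\<in>A. C = slit_chart A c \<and> w \<in> fst (slit_chart A c))"
  unfolding charts_at_def slit_atlas_def by blast

lemma points_slit_atlas: "points (slit_atlas A) = slit_bundle A"
proof -
  have "w \<in> points (slit_atlas A) \<longleftrightarrow> w \<in> slit_bundle A" for w
    unfolding smooth_atlas.points_iff[OF smooth_atlas_slit] charts_at_slit_iff
    using charts_at_slit_bundle in_slit_chart by blast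
  then show ?thesis by blast
qed

text \<open>The second derivative of the coordinate change enters through the fiber coordinate
  \<open>y \<mapsto> D\<phi>(x) y\<close>.\<close>

lemma slit_jacobian:
  assumes c: "c \<in> A" and d: "d \<in> A" and w: "w \<in> fst (slit_chart A c)" "w \<in> fst (slit_chart A d)"
  shows "jacobian (slit_chart A c) (slit_chart A d) w V =
    (jacobian c d (fst w) (fst V),
     frechet_derivative (\<lambda>z. frechet_derivative (snd d \<circ> chart_inv c) (at z) (snd w c))
       (at (snd c (fst w))) (fst V) + jacobian c d (fst w) (snd V))"
proof -
  let ?S = "snd c ` (fst c \<inter> fst d)"
  have w': "snd (slit_chart A c) w \<in> ?S \<times> (- {0})"
    using w slit_overlap[OF c d] by blast
  then have "snd c (fst w) \<in> ?S" by simp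
  note tangent_lift_has_derivative[OF open_overlap[OF c d] this smooth_transition[OF c d], of "snd w c"]
  then have "((snd (slit_chart A d) \<circ> chart_inv (slit_chart A c)) has_derivative
      (\<lambda>V. (jacobian c d (fst w) (fst V),
        frechet_derivative (\<lambda>z. frechet_derivative (snd d \<circ> chart_inv c) (at z) (snd w c))
         (at (snd c (fst w))) (fst V) + jacobian c d (fst w) (snd V)))) (at (snd c (fst w), snd w c))"
  proof (rule has_derivative_transform_within_open)
    show "open (?S \<times> (- {0::'e}))" by (intro open_Times open_overlap c d) auto
    show "(snd c (fst w), snd w c) \<in> ?S \<times> (- {0})" using w' by simp
  qed (use slit_transition[OF c d] in simp)
  then show ?thesis unfolding slit_chart_apply by (rule frechet_derivative_apply)
qed

end

subsection \<open>Topology\<close>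

text \<open>The union of countable bases of the pieces is a countable basis, because a set open in
  an open piece is open in \<open>X\<close>.\<close>

lemma second_countable_open_cover:
  assumes "countable \<U>" "\<And>U. U \<in> \<U> \<Longrightarrow> openin X U" "topspace X \<subseteq> \<Union>\<U>"
    and sc: "\<And>U. U \<in> \<U> \<Longrightarrow> second_countable (subtopology X U)"
  shows "second_countable X"
proof -
  have "\<forall>U\<in>\<U>. \<exists>\<B>. countable \<B> \<and> (\<forall>V\<in>\<B>. openin (subtopology X U) V) \<and>
      (\<forall>W x. openin (subtopology X U) W \<and> x \<in> W \<longrightarrow> (\<exists>V\<in>\<B>. x \<in> V \<and> V \<subseteq> W))"
    using sc unfolding second_countable_def by blast
  then obtain \<B> where \<B>: "\<And>U. U \<in> \<U> \<Longrightarrow> countable (\<B> U)"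
    "\<And>U V. U \<in> \<U> \<Longrightarrow> V \<in> \<B> U \<Longrightarrow> openin (subtopology X U) V"
    "\<And>U W x. U \<in> \<U> \<Longrightarrow> openin (subtopology X U) W \<Longrightarrow> x \<in> W \<Longrightarrow> \<exists>V\<in>\<B> U. x \<in> V \<and> V \<subseteq> W"
    by metis
  show ?thesis
    unfolding second_countable_def
  proof (intro exI[of _ "\<Union>U\<in>\<U>. \<B> U"] conjI ballI allI impI)
    show "countable (\<Union>U\<in>\<U>. \<B> U)" using assms(1) \<B>(1) by blast
    show "openin X V" if "V \<in> (\<Union>U\<in>\<U>. \<B> U)" for V
      using that \<B>(2) assms(2) openin_trans_full by blast
    fix W x assume W: "openin X W \<and> x \<in> W"
    then obtain U where U: "U \<in> \<U>" "x \<in> U" using assms(3) openin_subset by blast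
    have "openin (subtopology X U) (U \<inter> W)" using W by (simp add: openin_subtopology_Int2)
    then show "\<exists>V\<in>\<Union>U\<in>\<U>. \<B> U. x \<in> V \<and> V \<subseteq> W" using \<B>(3)[OF U(1), of "U \<inter> W" x] U W by blast
  qed
qed

lemma second_countable_euclidean:
  "second_countable (euclidean :: 'b::second_countable_topology topology)"
proof -
  obtain B :: "'b set set" where B: "countable B" "topological_basis B"
    using ex_countable_basis by blast
  have "\<exists>V\<in>B. x \<in> V \<and> V \<subseteq> U" if "open U" "x \<in> U" for U and x :: 'b
    using topological_basisE[OF B(2) that] by metis
  then show ?thesis
    unfolding second_countable_def open_openin[symmetric]
    using B(1) topological_basis_open[OF B(2)] by blast
qed

locale manifold_atlas = smooth_atlas A for A :: "('a, 'e::euclidean_space) atlas" +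
  fixes T :: "'a topology"
  assumes manifold: "smooth_manifold T A"
begin

lemma openin_slit_preimage:
  assumes "c \<in> A" "open N"
  shows "openin (slit_topology A) {w \<in> fst (slit_chart A c). snd (slit_chart A c) w \<in> N}"
proof -
  have "openin (tangent_topology A) {w \<in> fst (tangent_chart A c). snd (tangent_chart A c) w \<in> N}"
    unfolding tangent_topology_def by (rule topology_generated_by_Basis) (use assms in blast)
  then have "openin (slit_topology A)
      (slit_bundle A \<inter> {w \<in> fst (tangent_chart A c). snd (tangent_chart A c) w \<in> N})"
    unfolding slit_topology_def by (rule openin_subtopology_Int2)
  also have "slit_bundle A \<inter> {w \<in> fst (tangent_chart A c). snd (tangent_chart A c) w \<in> N} =
      {w \<in> fst (slit_chart A c). snd (slit_chart A c) w \<in> N}"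
    by (auto simp: slit_chart_def)
  finally show ?thesis .
qed

lemma topspace_slit_topology: "topspace (slit_topology A) = slit_bundle A"
proof
  show "topspace (slit_topology A) \<subseteq> slit_bundle A" by (simp add: slit_topology_def)
  show "slit_bundle A \<subseteq> topspace (slit_topology A)"
  proof
    fix w assume w: "w \<in> slit_bundle A"
    then obtain c where "c \<in> A" "w \<in> fst (slit_chart A c)"
      using charts_at_slit_bundle in_slit_chart by blast
    then show "w \<in> topspace (slit_topology A)"
      using openin_subset[OF openin_slit_preimage[of c UNIV]] by auto
  qed
qed

lemma openin_slit_chart: "c \<in> A \<Longrightarrow> openin (slit_topology A) (fst (slit_chart A c))"
  using openin_slit_preimage[of c UNIV] by simp

text \<open>Continuity need only be tested on the sets that generate the tangent topology; for maps
  into the slit bundle these can be taken from the slit charts.\<close>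

lemma continuous_map_into_slit:
  assumes "\<And>c N. c \<in> A \<Longrightarrow> open N \<Longrightarrow> openin X
      {x \<in> topspace X. f x \<in> fst (slit_chart A c) \<and> snd (slit_chart A c) (f x) \<in> N}"
    and "f ` topspace X \<subseteq> slit_bundle A"
  shows "continuous_map X (slit_topology A) f"
  unfolding slit_topology_def continuous_map_in_subtopology
proof
  show "continuous_map X (tangent_topology A) f"
    unfolding tangent_topology_def
  proof (rule continuous_on_generated_topo)
    fix U assume "U \<in> {{w \<in> fst (tangent_chart A c). snd (tangent_chart A c) w \<in> N} |c N. c \<in> A \<and> open N}"
    then obtain c N where c: "c \<in> A" "open N"
      and U: "U = {w \<in> fst (tangent_chart A c). snd (tangent_chart A c) w \<in> N}" by blast
    have "f -` U \<inter> topspace X =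
        {x \<in> topspace X. f x \<in> fst (slit_chart A c) \<and> snd (slit_chart A c) (f x) \<in> N}"
      using assms(2) by (auto simp: U slit_chart_def)
    then show "openin X (f -` U \<inter> topspace X)" using assms(1)[OF c] by simp
  next
    show "f ` topspace X \<subseteq>
        \<Union>{{w \<in> fst (tangent_chart A c). snd (tangent_chart A c) w \<in> N} |c N. c \<in> A \<and> open N}"
    proof
      fix w assume "w \<in> f ` topspace X"
      then have "w \<in> slit_bundle A" using assms(2) by blast
      then obtain c where "c \<in> A" "w \<in> fst (slit_chart A c)"
        using charts_at_slit_bundle in_slit_chart by blast
      then have "w \<in> {w \<in> fst (tangent_chart A c). snd (tangent_chart A c) w \<in> UNIV}"
        by (simp add: slit_chart_def)
      then show "w \<in> \<Union>{{w \<in> fst (tangent_chart A c). snd (tangent_chart A c) w \<in> N} |c N. c \<in> A \<and> open N}"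
        using \<open>c \<in> A\<close> open_UNIV by blast
    qed
  qed
  show "f \<in> topspace X \<rightarrow> slit_bundle A" using assms(2) by auto
qed

text \<open>The chart is continuous because preimages of open sets are open by construction. For the
  inverse, all other charts contribute generators too: the preimage of one coming from
  \<open>d\<close> is an open set pulled back by the continuous transition map to
  \<open>d\<close>.\<close>

lemma slit_chart_homeomorphic:
  assumes c: "c \<in> A"
  shows "homeomorphic_maps (subtopology (slit_topology A) (fst (slit_chart A c)))
    (top_of_set (chart_image (slit_chart A c))) (snd (slit_chart A c)) (chart_inv (slit_chart A c))"
proof -
  interpret slit: smooth_atlas "slit_atlas A" by (rule smooth_atlas_slit)
  let ?C = "slit_chart A c"
  let ?X = "subtopology (slit_topology A) (fst ?C)" and ?Y = "top_of_set (chart_image ?C)"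
  have C: "?C \<in> slit_atlas A" using c by (simp add: slit_atlas_def)
  have top: "topspace ?X = fst ?C"
    using openin_subset[OF openin_slit_chart[OF c]] by auto
  have "continuous_map ?X euclidean (snd ?C)"
    unfolding continuous_map
  proof (intro conjI allI impI)
    fix N :: "('e \<times> 'e) set" assume "openin euclidean N"
    then have "openin (slit_topology A) {w \<in> fst ?C. snd ?C w \<in> N}"
      using openin_slit_preimage[OF c] by simp
    then show "openin ?X {w \<in> topspace ?X. snd ?C w \<in> N}"
      unfolding top by (auto simp: openin_subtopology)
  qed auto
  then have 1: "continuous_map ?X ?Y (snd ?C)"
    by (simp add: continuous_map_in_subtopology top chart_image_def image_subset_iff_funcset)
  have "continuous_map ?Y (slit_topology A) (chart_inv ?C)"
  proof (rule continuous_map_into_slit)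
    fix d and N :: "('e \<times> 'e) set" assume d: "d \<in> A" and N: "open N"
    let ?D = "slit_chart A d"
    have D: "?D \<in> slit_atlas A" using d by (simp add: slit_atlas_def)
    have "open (snd ?C ` (fst ?C \<inter> fst ?D) \<inter> (snd ?D \<circ> chart_inv ?C) -` N)"
      by (rule continuous_open_preimage[OF smooth_on_imp_continuous_on[OF slit.smooth_transition[OF C D]]
          slit.open_overlap[OF C D] N])
    moreover have "snd ?C ` (fst ?C \<inter> fst ?D) \<inter> (snd ?D \<circ> chart_inv ?C) -` N =
        {z \<in> topspace ?Y. chart_inv ?C z \<in> fst ?D \<and> snd ?D (chart_inv ?C z) \<in> N}"
      by (rule set_eqI) (simp only: Int_iff slit.overlap_iff[OF C] vimage_eq mem_Collect_eq
          topspace_euclidean_subtopology o_apply conj_assoc)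
    ultimately have "open {z \<in> topspace ?Y. chart_inv ?C z \<in> fst ?D \<and> snd ?D (chart_inv ?C z) \<in> N}"
      by (simp only:)
    then show "openin ?Y
        {z \<in> topspace ?Y. chart_inv ?C z \<in> fst ?D \<and> snd ?D (chart_inv ?C z) \<in> N}"
      by (rule open_subset[rotated]) auto
  next
    show "chart_inv ?C ` topspace ?Y \<subseteq> slit_bundle A"
      using slit.chart_inv_in[of _ ?C] in_slit_chart[OF c] by auto
  qed
  then have 2: "continuous_map ?Y ?X (chart_inv ?C)"
    using slit.chart_inv_in[of _ ?C] by (auto simp: continuous_map_in_subtopology)
  show ?thesis
    unfolding homeomorphic_maps_def top
    using 1 2 slit.chart_inv_snd[OF C] slit.snd_chart_inv[of _ ?C] by auto
qed

lemma openin_image_chart: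
  assumes c: "c \<in> A" and U: "openin T U"
  shows "open (snd c ` (fst c \<inter> U))"
proof -
  have h: "homeomorphic_map (subtopology T (fst c)) (top_of_set (chart_image c)) (snd c)"
    using manifold c by (auto simp: smooth_manifold_def)
  have "openin (subtopology T (fst c)) (fst c \<inter> U)" using U by (simp add: openin_subtopology_Int2)
  then have "openin (top_of_set (chart_image c)) (snd c ` (fst c \<inter> U))"
    using homeomorphic_imp_open_map[OF h] by (auto simp: open_map_def)
  then show ?thesis using open_chart_image[OF c] openin_open_trans by blast
qed

text \<open>Continuity of the projection to the base: in a chart, the points above \<open>U\<close>
  form a cylinder over an open set.\<close>

lemma openin_slit_projection:
  assumes U: "openin T U"
  shows "openin (slit_topology A) {w \<in> slit_bundle A. fst w \<in> U}"
proof (subst openin_subopen, intro ballI)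
  fix w assume w: "w \<in> {w \<in> slit_bundle A. fst w \<in> U}"
  then obtain c where c: "c \<in> A" "w \<in> fst (slit_chart A c)"
    using charts_at_slit_bundle in_slit_chart by blast
  let ?N = "snd c ` (fst c \<inter> U) \<times> UNIV :: ('e \<times> 'e) set"
  let ?V = "{w \<in> fst (slit_chart A c). snd (slit_chart A c) w \<in> ?N}"
  have 1: "openin (slit_topology A) ?V"
    by (rule openin_slit_preimage[OF c(1)]) (intro open_Times openin_image_chart c U open_UNIV)
  have 2: "w \<in> ?V" using w c by (auto simp: in_slit_chart[OF c(1)])
  have 3: "?V \<subseteq> {w \<in> slit_bundle A. fst w \<in> U}"
    using overlap_iff[OF c(1), of _ U] chart_inv_snd[OF c(1)]
    by (auto simp: in_slit_chart[OF c(1)])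
  show "\<exists>V. openin (slit_topology A) V \<and> w \<in> V \<and> V \<subseteq> {w \<in> slit_bundle A. fst w \<in> U}"
    by (rule exI[of _ ?V]) (intro conjI 1 2 3)
qed

text \<open>Points over different base points are separated by preimages under the projection.
  Points over the same base point lie in a common chart domain, where injectivity of the chart
  reduces the claim to the model space.\<close>

lemma Hausdorff_slit: "Hausdorff_space (slit_topology A)"
  unfolding Hausdorff_space_def topspace_slit_topology
proof (intro allI impI)
  fix v w assume vw: "v \<in> slit_bundle A \<and> w \<in> slit_bundle A \<and> v \<noteq> w"
  show "\<exists>V W. openin (slit_topology A) V \<and> openin (slit_topology A) W \<and> v \<in> V \<and> w \<in> W \<and> disjnt V W"
  proof (cases "fst v = fst w")
    case False
    have "fst v \<in> topspace T" "fst w \<in> topspace T"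
      using vw manifold by (auto simp: in_slit_bundle smooth_manifold_def)
    then obtain V W where VW: "openin T V" "openin T W" "fst v \<in> V" "fst w \<in> W" "disjnt V W"
      using manifold False unfolding smooth_manifold_def Hausdorff_space_def by blast
    let ?P = "\<lambda>U. {w \<in> slit_bundle A. fst w \<in> U}"
    have "v \<in> ?P V" "w \<in> ?P W" "disjnt (?P V) (?P W)"
      using VW(3-5) vw by (auto simp: disjnt_iff)
    then show ?thesis
      using openin_slit_projection[OF VW(1)] openin_slit_projection[OF VW(2)] by blast
  next
    case True
    obtain c where c: "c \<in> A" "v \<in> fst (slit_chart A c)" "w \<in> fst (slit_chart A c)"
      using charts_at_slit_bundle[of v] vw True by (auto simp: in_slit_chart)
    have "snd (slit_chart A c) v \<noteq> snd (slit_chart A c) w"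
      using inj_onD[OF inj_slit_chart[OF c(1)]] c vw by blast
    then obtain M N where MN: "open M" "open N" "snd (slit_chart A c) v \<in> M"
        "snd (slit_chart A c) w \<in> N" "M \<inter> N = {}"
      using hausdorff by meson
    let ?P = "\<lambda>N. {w \<in> fst (slit_chart A c). snd (slit_chart A c) w \<in> N}"
    have "v \<in> ?P M" "w \<in> ?P N" "disjnt (?P M) (?P N)"
      using MN(3-5) c by (auto simp: disjnt_iff)
    then show ?thesis
      using openin_slit_preimage[OF c(1) MN(1)] openin_slit_preimage[OF c(1) MN(2)] by blast
  qed
qed

text \<open>The atlas may be uncountable. Since the base is Lindelof, countably many chart domains
  already cover it, and over each of them the slit bundle is homeomorphic to a subset of Euclidean
  space.\<close>

lemma second_countable_slit: "second_countable (slit_topology A)"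
proof -
  have "Lindelof_space T"
    using manifold second_countable_imp_Lindelof_space by (auto simp: smooth_manifold_def)
  moreover have "openin T U" if "U \<in> fst ` A" for U
    using manifold that by (auto simp: smooth_manifold_def)
  moreover have "\<Union> (fst ` A) = topspace T"
    using manifold by (auto simp: smooth_manifold_def points_def)
  ultimately obtain \<V> where \<V>: "countable \<V>" "\<V> \<subseteq> fst ` A" "\<Union>\<V> = topspace T"
    by (metis Lindelof_spaceD)
  then obtain C where C: "countable C" "C \<subseteq> A" "\<V> = fst ` C"
    using countable_subset_image by metis
  show ?thesis
  proof (rule second_countable_open_cover)
    show "countable ((\<lambda>c. fst (slit_chart A c)) ` C)" using C by blast
    show "topspace (slit_topology A) \<subseteq> \<Union>((\<lambda>c. fst (slit_chart A c)) ` C)"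
    proof
      fix w assume "w \<in> topspace (slit_topology A)"
      then have w: "w \<in> slit_bundle A" by (simp add: topspace_slit_topology)
      then have "fst w \<in> topspace T" using manifold by (simp add: in_slit_bundle smooth_manifold_def)
      then obtain c where "c \<in> C" "fst w \<in> fst c" using \<V> C by blast
      then show "w \<in> \<Union>((\<lambda>c. fst (slit_chart A c)) ` C)"
        using w C(2) in_slit_chart by blast
    qed
    fix U assume "U \<in> (\<lambda>c. fst (slit_chart A c)) ` C"
    then obtain c where c: "c \<in> A" "U = fst (slit_chart A c)" using C by blast
    show "openin (slit_topology A) U" using openin_slit_chart c by simp
    have "subtopology (slit_topology A) U homeomorphic_space top_of_set (chart_image (slit_chart A c))"
      using slit_chart_homeomorphic[OF c(1)] c(2) unfolding homeomorphic_space_def by blast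
    then show "second_countable (subtopology (slit_topology A) U)"
      using homeomorphic_space_second_countability second_countable_subtopology[OF second_countable_euclidean]
      by blast
  qed
qed

lemma smooth_manifold_slit: "smooth_manifold (slit_topology A) (slit_atlas A)"
  unfolding smooth_manifold_def
proof (intro conjI ballI)
  interpret slit: smooth_atlas "slit_atlas A" by (rule smooth_atlas_slit)
  show "Hausdorff_space (slit_topology A)" "second_countable (slit_topology A)"
    by (rule Hausdorff_slit second_countable_slit)+
  show "points (slit_atlas A) = topspace (slit_topology A)"
    by (simp add: points_slit_atlas topspace_slit_topology)
  fix C assume C: "C \<in> slit_atlas A"
  then obtain c where c: "c \<in> A" "C = slit_chart A c" by (auto simp: slit_atlas_def)
  show "openin (slit_topology A) (fst C)" using openin_slit_chart c by simp
  show "open (chart_image C)" by (rule slit.open_chart_image[OF C])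
  show "homeomorphic_map (subtopology (slit_topology A) (fst C)) (top_of_set (chart_image C)) (snd C)"
    unfolding homeomorphic_map_maps c(2) using slit_chart_homeomorphic[OF c(1)] by blast
  show "smooth_on (snd C ` (fst C \<inter> fst D)) (snd D \<circ> chart_inv C)" if "D \<in> slit_atlas A" for D
    by (rule slit.smooth_transition[OF C that])
qed

end

section \<open>Families of bilinear forms\<close>

lemma bilinear_expand_Basis:
  fixes f :: "'e::euclidean_space \<Rightarrow> 'e \<Rightarrow> real"
  assumes "bilinear f"
  shows "f u v = (\<Sum>i\<in>Basis. \<Sum>j\<in>Basis. (u \<bullet> i) * ((v \<bullet> j) * f i j))"
proof -
  have l: "linear (\<lambda>u. f u v)" "linear (f i)" for v i using assms by (auto simp: bilinear_def)
  have "f u v = (\<Sum>i\<in>Basis. (u \<bullet> i) * f i v)"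
    using linear_expand_Basis[OF l(1), of u v] by simp
  also have "\<dots> = (\<Sum>i\<in>Basis. (u \<bullet> i) * (\<Sum>j\<in>Basis. (v \<bullet> j) * f i j))"
    by (intro sum.cong refl arg_cong2[of _ _ _ _ "(*)"])
      (use linear_expand_Basis[OF l(2), of _ v] in simp)
  finally show ?thesis by (simp add: sum_distrib_left)
qed

lemma bilinear_of_Basis:
  fixes F :: "'e::euclidean_space \<Rightarrow> 'e \<Rightarrow> real"
  shows "bilinear (\<lambda>u v. \<Sum>i\<in>Basis. \<Sum>j\<in>Basis. (u \<bullet> i) * ((v \<bullet> j) * F i j))"
  unfolding bilinear_def
  by (intro conjI allI linearI)
    (simp_all add: inner_add_left distrib_right distrib_left sum.distrib sum_distrib_left mult_ac)

lemma bilinear_lincomb: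
  fixes f :: "'e::real_vector \<Rightarrow> 'e \<Rightarrow> real"
  assumes "bilinear f"
  shows "f (a *\<^sub>R u + b *\<^sub>R v) w = a * f u w + b * f v w"
    and "f w (a *\<^sub>R u + b *\<^sub>R v) = a * f w u + b * f w v"
  by (simp_all add: bilinear_ladd[OF assms] bilinear_radd[OF assms]
      bilinear_lmul[OF assms] bilinear_rmul[OF assms])

text \<open>The expression of a (0,2) field in a single chart, with the base point \<open>x\<close>
  as parameter. All calculus of the lift takes place at this level, detached from manifold and
  charts.\<close>

locale bilinear_family =
  fixes S :: "'e::euclidean_space set" and B :: "'e \<Rightarrow> 'e \<Rightarrow> 'e \<Rightarrow> real"
  assumes open_S: "open S"
    and bilinear_B: "x \<in> S \<Longrightarrow> bilinear (B x)"
    and smooth_B: "smooth_on S (\<lambda>x. B x u v)"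
begin

definition deriv_B :: "'e \<Rightarrow> 'e \<Rightarrow> 'e \<Rightarrow> 'e \<Rightarrow> real" where
  "deriv_B x y u v = frechet_derivative (\<lambda>z. B z u v) (at x) y"

lemma B_has_derivative: "x \<in> S \<Longrightarrow> ((\<lambda>z. B z u v) has_derivative (\<lambda>y. deriv_B x y u v)) (at x)"
  unfolding deriv_B_def by (rule smooth_on_has_derivative[OF smooth_B])

text \<open>For constant \<open>u\<close> and \<open>v\<close>, the expansion of
  \<open>B z u v\<close> has constant coefficients, so it may be differentiated term by term. This
  yields bilinearity of the derivative.\<close>

lemma deriv_B_expand:
  assumes x: "x \<in> S"
  shows "deriv_B x y u v = (\<Sum>i\<in>Basis. \<Sum>j\<in>Basis. (u \<bullet> i) * ((v \<bullet> j) * deriv_B x y i j))"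
proof -
  have "((\<lambda>z. \<Sum>i\<in>Basis. \<Sum>j\<in>Basis. (u \<bullet> i) * ((v \<bullet> j) * B z i j)) has_derivative
      (\<lambda>y. \<Sum>i\<in>Basis. \<Sum>j\<in>Basis. (u \<bullet> i) * ((v \<bullet> j) * deriv_B x y i j))) (at x)"
    by (intro has_derivative_sum has_derivative_mult_right B_has_derivative x)
  then have "((\<lambda>z. B z u v) has_derivative
      (\<lambda>y. \<Sum>i\<in>Basis. \<Sum>j\<in>Basis. (u \<bullet> i) * ((v \<bullet> j) * deriv_B x y i j))) (at x)"
    by (rule has_derivative_transform_within_open[OF _ open_S x])
      (rule bilinear_expand_Basis[OF bilinear_B, symmetric])
  then show ?thesis unfolding deriv_B_def[of x y u v] by (rule frechet_derivative_apply)
qed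

lemma bilinear_deriv_B:
  assumes "x \<in> S"
  shows "bilinear (deriv_B x y)"
proof -
  have "deriv_B x y = (\<lambda>u v. \<Sum>i\<in>Basis. \<Sum>j\<in>Basis. (u \<bullet> i) * ((v \<bullet> j) * deriv_B x y i j))"
    by (intro ext) (rule deriv_B_expand[OF assms])
  then show ?thesis by (rule arg_cong[of _ _ bilinear, THEN iffD2]) (rule bilinear_of_Basis)
qed

lemma linear_deriv_B: "x \<in> S \<Longrightarrow> linear (\<lambda>y. deriv_B x y u v)"
  using B_has_derivative has_derivative_linear by blast

text \<open>Chain and product rule when base point and both arguments vary together. It is applied
  to a transition map \<phi> and to images of two fixed vectors under its differential.\<close>

lemma B_compose_has_derivative:
  assumes N: "open N" "x \<in> N" "\<phi> ` N \<subseteq> S"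
    and \<phi>: "(\<phi> has_derivative \<phi>') (at x)"
    and a: "(a has_derivative a') (at x)" and b: "(b has_derivative b') (at x)"
  shows "((\<lambda>z. B (\<phi> z) (a z) (b z)) has_derivative
    (\<lambda>h. deriv_B (\<phi> x) (\<phi>' h) (a x) (b x) + B (\<phi> x) (a' h) (b x) + B (\<phi> x) (a x) (b' h))) (at x)"
proof -
  have x: "\<phi> x \<in> S" using N by auto
  have Bij: "((\<lambda>z. B (\<phi> z) i j) has_derivative (\<lambda>h. deriv_B (\<phi> x) (\<phi>' h) i j)) (at x)" for i j
    by (rule has_derivative_compose[OF \<phi> B_has_derivative[OF x]])
  have inner: "((\<lambda>z. a z \<bullet> i) has_derivative (\<lambda>h. a' h \<bullet> i)) (at x)"
    "((\<lambda>z. b z \<bullet> i) has_derivative (\<lambda>h. b' h \<bullet> i)) (at x)" for i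
    using a b by (auto intro: has_derivative_inner_left)
  have d: "((\<lambda>z. (a z \<bullet> i) * ((b z \<bullet> j) * B (\<phi> z) i j)) has_derivative
      (\<lambda>h. (a x \<bullet> i) * ((b x \<bullet> j) * deriv_B (\<phi> x) (\<phi>' h) i j) +
        (a' h \<bullet> i) * ((b x \<bullet> j) * B (\<phi> x) i j) +
        (a x \<bullet> i) * ((b' h \<bullet> j) * B (\<phi> x) i j))) (at x)" for i j
    using has_derivative_mult[OF inner(1)[of i] has_derivative_mult[OF inner(2)[of j] Bij[of i j]]]
    by (simp add: algebra_simps)
  let ?L = "\<lambda>h. \<Sum>i\<in>Basis. \<Sum>j\<in>Basis. (a x \<bullet> i) * ((b x \<bullet> j) * deriv_B (\<phi> x) (\<phi>' h) i j) +
        (a' h \<bullet> i) * ((b x \<bullet> j) * B (\<phi> x) i j) +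
        (a x \<bullet> i) * ((b' h \<bullet> j) * B (\<phi> x) i j)"
  have "((\<lambda>z. \<Sum>i\<in>Basis. \<Sum>j\<in>Basis. (a z \<bullet> i) * ((b z \<bullet> j) * B (\<phi> z) i j)) has_derivative ?L) (at x)"
    by (intro has_derivative_sum d)
  then have "((\<lambda>z. B (\<phi> z) (a z) (b z)) has_derivative ?L) (at x)"
  proof (rule has_derivative_transform_within_open[OF _ N(1,2)])
    show "(\<Sum>i\<in>Basis. \<Sum>j\<in>Basis. (a z \<bullet> i) * ((b z \<bullet> j) * B (\<phi> z) i j)) = B (\<phi> z) (a z) (b z)"
      if "z \<in> N" for z
      using that N(3) by (intro bilinear_expand_Basis[symmetric] bilinear_B) auto
  qed
  moreover have "?L h = deriv_B (\<phi> x) (\<phi>' h) (a x) (b x) + B (\<phi> x) (a' h) (b x) + B (\<phi> x) (a x) (b' h)"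
    for h
    unfolding sum.distrib by (intro arg_cong2[of _ _ _ _ "(+)"] deriv_B_expand[symmetric] x
        bilinear_expand_Basis[OF bilinear_B[OF x], symmetric])
  ultimately show ?thesis by simp
qed

lemma smooth_on_B_snd:
  "smooth_on (S \<times> UNIV) (\<lambda>z. B (fst z) (snd z) (snd z))"
proof (rule smooth_on_cong)
  show op: "open (S \<times> (UNIV :: 'e set))" by (intro open_Times open_S open_UNIV)
  show "smooth_on (S \<times> UNIV) (\<lambda>z. \<Sum>i\<in>Basis. \<Sum>j\<in>Basis.
      (snd z \<bullet> i) * ((snd z \<bullet> j) * B (fst z) i j))"
    by (intro smooth_on_sum smooth_on_mult op smooth_on_snd_inner smooth_on_fst[OF open_S smooth_B])
  show "(\<Sum>i\<in>Basis. \<Sum>j\<in>Basis. (snd z \<bullet> i) * ((snd z \<bullet> j) * B (fst z) i j)) =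
      B (fst z) (snd z) (snd z)" if "z \<in> S \<times> UNIV" for z
    using that by (intro bilinear_expand_Basis[symmetric] bilinear_B) auto
qed

lemma smooth_on_deriv_B_snd: "smooth_on (S \<times> UNIV) (\<lambda>z. deriv_B (fst z) (snd z) u v)"
  unfolding deriv_B_def by (rule smooth_on_frechet_derivative_snd[OF open_S smooth_B])

text \<open>In induced coordinates, \<open>(2 / \<parallel>y\<parallel>) g\<^sub>i\<^sub>j dx\<^sup>i \<delta>y\<^sup>j\<close> is \<open>2 / \<parallel>y\<parallel>\<close> times the complete lift of the
  form \<open>B\<close>: after symmetrization the Christoffel terms add up to the derivative of \<open>B\<close>
  in the direction \<open>y\<close>.\<close>

definition lift_B :: "'e \<times> 'e \<Rightarrow> 'e \<times> 'e \<Rightarrow> 'e \<times> 'e \<Rightarrow> real" where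
  "lift_B z V W = 2 / sqrt (B (fst z) (snd z) (snd z)) *
     (B (fst z) (fst V) (snd W) + B (fst z) (snd V) (fst W) + deriv_B (fst z) (snd z) (fst V) (fst W))"

lemma bilinear_lift_B:
  assumes "fst z \<in> S"
  shows "bilinear (lift_B z)"
  unfolding lift_B_def[abs_def]
  by (intro bilinear_def[THEN iffD2] conjI allI linearI)
    (simp_all add: bilinear_ladd[OF bilinear_B] bilinear_radd[OF bilinear_B]
      bilinear_lmul[OF bilinear_B] bilinear_rmul[OF bilinear_B]
      bilinear_ladd[OF bilinear_deriv_B] bilinear_radd[OF bilinear_deriv_B]
      bilinear_lmul[OF bilinear_deriv_B] bilinear_rmul[OF bilinear_deriv_B] assms
      algebra_simps)

end

section \<open>Positive definite families and the properties of their lift\<close>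

locale metric_family = bilinear_family +
  assumes sym_B: "x \<in> S \<Longrightarrow> B x u v = B x v u"
    and pos_B: "x \<in> S \<Longrightarrow> u \<noteq> 0 \<Longrightarrow> B x u u > 0"
begin

lemma deriv_B_sym:
  assumes "x \<in> S"
  shows "deriv_B x y u v = deriv_B x y v u"
proof -
  have "((\<lambda>z. B z v u) has_derivative (\<lambda>y. deriv_B x y u v)) (at x)"
    by (rule has_derivative_transform_within_open[OF B_has_derivative[OF assms] open_S assms])
      (rule sym_B)
  then show ?thesis unfolding deriv_B_def[of x y v u] by (rule frechet_derivative_apply[symmetric])
qed

lemma lift_B_sym: "fst z \<in> S \<Longrightarrow> lift_B z V W = lift_B z W V"
  using sym_B[of "fst z" "fst V" "snd W"] sym_B[of "fst z" "snd V" "fst W"]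
    deriv_B_sym[of "fst z" "snd z" "fst V" "fst W"]
  by (simp add: lift_B_def add_ac)

lemma sqrt_B_pos: "x \<in> S \<Longrightarrow> y \<noteq> 0 \<Longrightarrow> sqrt (B x y y) > 0"
  using pos_B by simp

text \<open>Testing against the vertical vector with fiber part \<open>fst V\<close> leaves only
  \<open>B\<close> on \<open>fst V\<close>, which must vanish. Once \<open>fst V = 0\<close>, the
  vector with base part \<open>snd V\<close> does the same for \<open>snd V\<close>.\<close>

lemma lift_B_nondegenerate:
  assumes z: "fst z \<in> S" "snd z \<noteq> 0" and 0: "\<And>W. lift_B z V W = 0"
  shows "V = 0"
proof -
  note b = bilinear_B[OF z(1)]
  have n: "sqrt (B (fst z) (snd z) (snd z)) \<noteq> 0" using sqrt_B_pos[OF z] by simp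
  have 1: "fst V = 0"
  proof (rule ccontr)
    assume v: "fst V \<noteq> 0"
    have "B (fst z) (fst V) (fst V) = 0"
      using 0[of "(0, fst V)"] n
      by (simp add: lift_B_def bilinear_rzero[OF b] bilinear_rzero[OF bilinear_deriv_B[OF z(1)]])
    then show False using pos_B[OF z(1) v] by simp
  qed
  have "snd V = 0"
  proof (rule ccontr)
    assume v: "snd V \<noteq> 0"
    have "B (fst z) (snd V) (snd V) = 0"
      using 0[of "(snd V, 0)"] n 1
      by (simp add: lift_B_def bilinear_lzero[OF b] bilinear_lzero[OF bilinear_deriv_B[OF z(1)]])
    then show False using pos_B[OF z(1) v] by simp
  qed
  with 1 show ?thesis by (simp add: prod_eq_iff)
qed

text \<open>Each of the three summands contains exactly one scaled argument: \<open>snd W\<close>,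
  \<open>snd V\<close> or the direction \<open>snd z\<close> of the derivative. The resulting factor
  \<open>t\<close> cancels against the one from the norm.\<close>

lemma lift_B_homogeneous:
  assumes "fst z \<in> S" "t > 0"
  shows "lift_B (fst z, t *\<^sub>R snd z) (fst V, t *\<^sub>R snd V) (fst W, t *\<^sub>R snd W) = lift_B z V W"
proof -
  note b = bilinear_B[OF assms(1)]
  have "B (fst z) (t *\<^sub>R snd z) (t *\<^sub>R snd z) = t\<^sup>2 * B (fst z) (snd z) (snd z)"
    by (simp add: bilinear_lmul[OF b] bilinear_rmul[OF b] power2_eq_square)
  then have norm: "sqrt (B (fst z) (t *\<^sub>R snd z) (t *\<^sub>R snd z)) = t * sqrt (B (fst z) (snd z) (snd z))"
    using assms(2) by (simp add: real_sqrt_mult)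
  have scale: "2 / (t * s) * (t *\<^sub>R a + t *\<^sub>R b + t *\<^sub>R c) = 2 / s * (a + b + c)" for s a b c :: real
  proof -
    have "t *\<^sub>R a + t *\<^sub>R b + t *\<^sub>R c = t * (a + b + c)" by (simp add: algebra_simps)
    then show ?thesis using assms(2) by simp
  qed
  show ?thesis
    unfolding lift_B_def fst_conv snd_conv norm
    unfolding bilinear_lmul[OF b] bilinear_rmul[OF b]
      linear_scale[OF linear_deriv_B[OF assms(1)]] by (rule scale)
qed

lemma smooth_on_lift_B: "smooth_on (S \<times> (- {0})) (\<lambda>z. lift_B z V W)"
proof (rule smooth_on_cong)
  show op: "open (S \<times> (- {0::'a}))" by (intro open_Times open_S) auto
  have sub: "S \<times> (- {0::'a}) \<subseteq> S \<times> UNIV" by auto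
  \<comment> \<open>The reciprocal square root is written as a power, smooth because its base is
    positive away from the zero section.\<close>
  show "smooth_on (S \<times> (- {0})) (\<lambda>z. 2 * B (fst z) (snd z) (snd z) powr (- 1 / 2) *
     (B (fst z) (fst V) (snd W) + B (fst z) (snd V) (fst W) + deriv_B (fst z) (snd z) (fst V) (fst W)))"
    by (intro smooth_on_mult smooth_on_add smooth_on_powr smooth_on_const op
        smooth_on_mono[OF smooth_on_B_snd sub] smooth_on_mono[OF smooth_on_deriv_B_snd sub]
        smooth_on_mono[OF smooth_on_fst[OF open_S smooth_B] sub]) (auto intro: pos_B)
  show "2 * B (fst z) (snd z) (snd z) powr (- 1 / 2) *
     (B (fst z) (fst V) (snd W) + B (fst z) (snd V) (fst W) + deriv_B (fst z) (snd z) (fst V) (fst W)) =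
     lift_B z V W" if "z \<in> S \<times> (- {0})" for z
  proof -
    have "B (fst z) (snd z) (snd z) > 0" using that by (auto intro: pos_B)
    then have "B (fst z) (snd z) (snd z) powr (- 1 / 2) = 1 / sqrt (B (fst z) (snd z) (snd z))"
      by (simp add: powr_minus_divide powr_half_sqrt)
    then show ?thesis by (simp add: lift_B_def)
  qed
qed

end

section \<open>The lift in coordinates\<close>

definition metric_form ::
    "('a, 'e::euclidean_space) atlas \<Rightarrow> ('a, 'e) field02 \<Rightarrow> ('a, 'e) chart \<Rightarrow> 'e \<Rightarrow> 'e \<Rightarrow> 'e \<Rightarrow> real" where
  "metric_form A g c x u v =
     g (chart_inv c x) (tvec A c (chart_inv c x) u) (tvec A c (chart_inv c x) v)"

locale riemannian_atlas = manifold_atlas A T for A :: "('a, 'e::euclidean_space) atlas" and T +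
  fixes g :: "('a, 'e) field02"
  assumes riemannian: "riemannian_manifold T A g"
begin

lemma tensor_g: "tensor_field02 A g"
  using riemannian by (simp add: riemannian_manifold_def smooth_field02_def)

lemma charts_at_chart_inv: "c \<in> A \<Longrightarrow> x \<in> chart_image c \<Longrightarrow> c \<in> charts_at A (chart_inv c x)"
  by (simp add: charts_at_iff chart_inv_in)

lemma metric_form_bilinear:
  "c \<in> A \<Longrightarrow> x \<in> chart_image c \<Longrightarrow> bilinear (metric_form A g c x)"
  unfolding metric_form_def[abs_def] by (rule field02_bilinear[OF tensor_g charts_at_chart_inv])

lemma metric_form_family:
  assumes c: "c \<in> A"
  shows "metric_family (chart_image c) (metric_form A g c)"
proof
  show "open (chart_image c)" by (rule open_chart_image[OF c])
  show "bilinear (metric_form A g c x)" if "x \<in> chart_image c" for x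
    by (rule metric_form_bilinear[OF c that])
  fix u v
  show "smooth_on (chart_image c) (\<lambda>x. metric_form A g c x u v)"
  proof (rule smooth_on_cong[OF open_chart_image[OF c]])
    have "smooth_on (chart_image c) (\<lambda>x. metric_form A g c x i j)" if "i \<in> Basis" "j \<in> Basis" for i j
      using riemannian c that unfolding riemannian_manifold_def smooth_field02_def metric_form_def
      by blast
    then show "smooth_on (chart_image c)
        (\<lambda>x. \<Sum>i\<in>Basis. \<Sum>j\<in>Basis. (u \<bullet> i) * ((v \<bullet> j) * metric_form A g c x i j))"
      by (intro smooth_on_sum smooth_on_mult smooth_on_const open_chart_image c)
    show "(\<Sum>i\<in>Basis. \<Sum>j\<in>Basis. (u \<bullet> i) * ((v \<bullet> j) * metric_form A g c x i j)) =
        metric_form A g c x u v" if "x \<in> chart_image c" for x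
      by (rule bilinear_expand_Basis[OF metric_form_bilinear[OF c that], symmetric])
  qed
  fix x assume x: "x \<in> chart_image c"
  note p = charts_at_chart_inv[OF c x]
  then have p': "chart_inv c x \<in> points A" using points_iff by blast
  show "metric_form A g c x u v = metric_form A g c x v u"
    using riemannian p' tvec_in_tangent_space[OF p]
    unfolding riemannian_manifold_def symmetric_field02_def metric_form_def by blast
  show "metric_form A g c x u u > 0" if "u \<noteq> 0"
    using riemannian p' tvec_in_tangent_space[OF p] tvec_eq_zero_iff[OF p, of u] that
    unfolding riemannian_manifold_def metric_form_def by blast
qed

text \<open>Named with the chart as an argument, since the transformation laws below relate the
  derivatives in two charts within one statement.\<close>

definition metric_deriv :: "('a, 'e) chart \<Rightarrow> 'e \<Rightarrow> 'e \<Rightarrow> 'e \<Rightarrow> 'e \<Rightarrow> real" where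
  "metric_deriv c = bilinear_family.deriv_B (metric_form A g c)"

definition lift_form :: "('a, 'e) chart \<Rightarrow> 'e \<times> 'e \<Rightarrow> 'e \<times> 'e \<Rightarrow> 'e \<times> 'e \<Rightarrow> real" where
  "lift_form c = bilinear_family.lift_B (metric_form A g c)"

section \<open>Transformation under coordinate changes\<close>

lemma metric_form_change:
  assumes c: "c \<in> charts_at A p" and d: "d \<in> charts_at A p"
  shows "metric_form A g c (snd c p) u v =
    metric_form A g d (snd d p) (jacobian c d p u) (jacobian c d p v)"
  using c d by (simp add: metric_form_def charts_at_iff chart_inv_snd tvec_change[OF c d])

text \<open>The vectors \<open>u\<close> and \<open>v\<close> are constant in the coordinates of
  \<open>c\<close>, but their images under the differential of the transition vary with the point.
  The terms with \<open>H\<close> record this variation.\<close>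

lemma metric_deriv_change:
  assumes c: "c \<in> charts_at A p" and d: "d \<in> charts_at A p"
  defines "H \<equiv> \<lambda>u. frechet_derivative
    (\<lambda>z. frechet_derivative (snd d \<circ> chart_inv c) (at z) u) (at (snd c p))"
  shows "metric_deriv c (snd c p) y u v =
    metric_deriv d (snd d p) (jacobian c d p y) (jacobian c d p u) (jacobian c d p v) +
    metric_form A g d (snd d p) (H u y) (jacobian c d p v) +
    metric_form A g d (snd d p) (jacobian c d p u) (H v y)"
proof -
  have A: "c \<in> A" "d \<in> A" and p: "p \<in> fst c" "p \<in> fst d" using c d by (auto simp: charts_at_iff)
  let ?\<phi> = "snd d \<circ> chart_inv c" and ?N = "snd c ` (fst c \<inter> fst d)"
  interpret C: metric_family "chart_image c" "metric_form A g c" by (rule metric_form_family[OF A(1)])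
  interpret D: metric_family "chart_image d" "metric_form A g d" by (rule metric_form_family[OF A(2)])
  note N = open_overlap[OF A]
  have x: "snd c p \<in> ?N" using p by blast
  have \<phi>x: "?\<phi> (snd c p) = snd d p" by (rule transition_snd[OF A(1) p(1)])
  have sub: "?\<phi> ` ?N \<subseteq> chart_image d"
    using A(1) by (auto simp: chart_inv_snd chart_image_def)
  have H: "((\<lambda>z. frechet_derivative ?\<phi> (at z) u) has_derivative H u) (at (snd c p))" for u
    unfolding H_def
    by (rule smooth_on_has_derivative[OF smooth_on_frechet_derivative[OF smooth_transition[OF A]] x])
  have "((\<lambda>z. metric_form A g d (?\<phi> z) (frechet_derivative ?\<phi> (at z) u) (frechet_derivative ?\<phi> (at z) v))
     has_derivative (\<lambda>h. D.deriv_B (?\<phi> (snd c p)) (jacobian c d p h) (jacobian c d p u) (jacobian c d p v) +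
       metric_form A g d (?\<phi> (snd c p)) (H u h) (jacobian c d p v) +
       metric_form A g d (?\<phi> (snd c p)) (jacobian c d p u) (H v h))) (at (snd c p))"
    by (rule D.B_compose_has_derivative[OF N x sub transition_has_derivative[OF A p] H H])
  then have "((\<lambda>z. metric_form A g c z u v)
     has_derivative (\<lambda>h. D.deriv_B (?\<phi> (snd c p)) (jacobian c d p h) (jacobian c d p u) (jacobian c d p v) +
       metric_form A g d (?\<phi> (snd c p)) (H u h) (jacobian c d p v) +
       metric_form A g d (?\<phi> (snd c p)) (jacobian c d p u) (H v h))) (at (snd c p))"
  proof (rule has_derivative_transform_within_open[OF _ N x])
    fix z assume "z \<in> ?N"
    then obtain q where q: "q \<in> fst c" "q \<in> fst d" "z = snd c q" by blast
    have "c \<in> charts_at A q" "d \<in> charts_at A q" using q A by (simp_all add: charts_at_iff)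
    from metric_form_change[OF this, of u v]
    show "metric_form A g d (?\<phi> z) (frechet_derivative ?\<phi> (at z) u) (frechet_derivative ?\<phi> (at z) v) =
        metric_form A g c z u v"
      unfolding q(3) transition_snd[OF A(1) q(1)] by (rule sym)
  qed
  then show ?thesis
    unfolding metric_deriv_def C.deriv_B_def \<phi>x by (rule frechet_derivative_apply)
qed

text \<open>The base-to-fiber part of \<open>J\<close> adds second-derivative terms to the two mixed
  summands for \<open>d\<close>; \<open>metric_deriv_change\<close> supplies the same terms for
  \<open>c\<close>. The norms agree because \<open>y\<close> transforms as a tangent vector.\<close>

lemma lift_form_change:
  assumes A: "c \<in> A" "d \<in> A" and w: "w \<in> fst (slit_chart A c)" "w \<in> fst (slit_chart A d)"
  defines "J \<equiv> jacobian (slit_chart A c) (slit_chart A d) w"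
  shows "lift_form d (snd (slit_chart A d) w) (J V) (J W) = lift_form c (snd (slit_chart A c) w) V W"
proof -
  let ?p = "fst w" and ?y = "snd w c"
  let ?j = "jacobian c d ?p"
  let ?H = "\<lambda>u. frechet_derivative
    (\<lambda>z. frechet_derivative (snd d \<circ> chart_inv c) (at z) u) (at (snd c ?p))"
  interpret C: metric_family "chart_image c" "metric_form A g c" by (rule metric_form_family[OF A(1)])
  interpret D: metric_family "chart_image d" "metric_form A g d" by (rule metric_form_family[OF A(2)])
  have p: "?p \<in> fst c" "?p \<in> fst d" and tv: "snd w \<in> tangent_space A ?p"
    using w by (auto simp: in_slit_chart A in_slit_bundle)
  have at: "c \<in> charts_at A ?p" "d \<in> charts_at A ?p" using p A by (simp_all add: charts_at_iff)
  have y: "snd w d = ?j ?y" by (rule tangent_space_change[OF tv at])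
  have "snd c ?p \<in> snd c ` (fst c \<inter> fst d)" using p by blast
  note Hsym = second_derivative_symmetric[OF open_overlap[OF A] this smooth_transition[OF A]]
  have "snd d ?p \<in> chart_image d" using p(2) by (auto simp: chart_image_def)
  note b = D.bilinear_B[OF this]
  have J: "J V = (?j (fst V), ?H ?y (fst V) + ?j (snd V))" for V
    unfolding J_def by (rule slit_jacobian[OF A w])
  \<comment> \<open>Differentiating the metric gives \<open>?H (fst V) ?y\<close>, while the
    Jacobian of the slit charts gives \<open>?H ?y (fst V)\<close>; the same holds for
    \<open>W\<close>. Symmetry of second derivatives matches them.\<close>
  have "metric_deriv c (snd c ?p) ?y (fst V) (fst W) =
    metric_deriv d (snd d ?p) (?j ?y) (?j (fst V)) (?j (fst W)) +
    metric_form A g d (snd d ?p) (?H ?y (fst V)) (?j (fst W)) +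
    metric_form A g d (snd d ?p) (?j (fst V)) (?H ?y (fst W))"
    using metric_deriv_change[OF at, of ?y "fst V" "fst W"]
    unfolding Hsym[of "fst V" ?y] Hsym[of "fst W" ?y] .
  then show ?thesis
    unfolding lift_form_def C.lift_B_def D.lift_B_def J slit_chart_apply y fst_conv snd_conv
      metric_form_change[OF at] bilinear_ladd[OF b] bilinear_radd[OF b] metric_deriv_def
    by (simp add: add_ac)
qed

text \<open>The chart is chosen arbitrarily, which is harmless by \<open>lift_form_change\<close>.
  The value 0 off the tangent spaces is the normalization of \<open>tensor_field02\<close>, so that
  uniqueness can be an equality of functions.\<close>

definition homogeneous_lift :: "(('a, 'e) tpoint, 'e \<times> 'e) field02" where
  "homogeneous_lift w X Y =
    (if w \<in> slit_bundle A \<and> X \<in> tangent_space (slit_atlas A) w \<and> Y \<in> tangent_space (slit_atlas A) w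
     then let c = SOME c. c \<in> charts_at A (fst w) in
       lift_form c (snd (slit_chart A c) w) (X (slit_chart A c)) (Y (slit_chart A c))
     else 0)"

text \<open>Both vectors are transported to the chosen chart by the Jacobian, and invariance of
  \<open>lift_form\<close> brings the value back to \<open>c\<close>. From here on any convenient
  chart can be used.\<close>

lemma homogeneous_lift_eq:
  assumes c: "c \<in> A" and w: "w \<in> fst (slit_chart A c)"
    and X: "X \<in> tangent_space (slit_atlas A) w" and Y: "Y \<in> tangent_space (slit_atlas A) w"
  shows "homogeneous_lift w X Y =
    lift_form c (snd (slit_chart A c) w) (X (slit_chart A c)) (Y (slit_chart A c))"
proof -
  interpret slit: smooth_atlas "slit_atlas A" by (rule smooth_atlas_slit)
  define d where "d = (SOME d. d \<in> charts_at A (fst w))"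
  have w': "w \<in> slit_bundle A" using w in_slit_chart[OF c] by blast
  have "c \<in> charts_at A (fst w)" using w c by (simp add: charts_at_iff in_slit_chart)
  then have "d \<in> charts_at A (fst w)" unfolding d_def by (rule someI)
  then have d: "d \<in> A" "w \<in> fst (slit_chart A d)"
    using w' by (simp_all add: charts_at_iff in_slit_chart)
  have at: "slit_chart A c \<in> charts_at (slit_atlas A) w" "slit_chart A d \<in> charts_at (slit_atlas A) w"
    using c w d by (auto simp: charts_at_slit_iff)
  have "homogeneous_lift w X Y =
      lift_form d (snd (slit_chart A d) w) (X (slit_chart A d)) (Y (slit_chart A d))"
    using w' X Y by (simp add: homogeneous_lift_def d_def Let_def)
  also have "\<dots> = lift_form c (snd (slit_chart A c) w) (X (slit_chart A c)) (Y (slit_chart A c))"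
    unfolding slit.tangent_space_change[OF X at] slit.tangent_space_change[OF Y at]
    by (rule lift_form_change[OF c d(1) w d(2)])
  finally show ?thesis .
qed

lemma slit_base_in: "c \<in> A \<Longrightarrow> w \<in> fst (slit_chart A c) \<Longrightarrow> snd c (fst w) \<in> chart_image c"
  by (auto simp: in_slit_chart chart_image_def)

lemma bilinear_lift_form:
  assumes "c \<in> A" "fst z \<in> chart_image c"
  shows "bilinear (lift_form c z)"
proof -
  interpret C: metric_family "chart_image c" "metric_form A g c" by (rule metric_form_family[OF assms(1)])
  show ?thesis unfolding lift_form_def by (rule C.bilinear_lift_B[OF assms(2)])
qed

lemma slit_charts_atE:
  assumes "w \<in> points (slit_atlas A)"
  obtains c where "c \<in> A" "w \<in> fst (slit_chart A c)"
  using assms charts_at_slit_bundle in_slit_chart unfolding points_slit_atlas by blast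

lemma tensor_homogeneous_lift: "tensor_field02 (slit_atlas A) homogeneous_lift"
  unfolding tensor_field02_def
proof (intro conjI ballI allI impI)
  interpret slit: smooth_atlas "slit_atlas A" by (rule smooth_atlas_slit)
  fix w assume "w \<in> points (slit_atlas A)"
  then obtain c where c: "c \<in> A" and w: "w \<in> fst (slit_chart A c)" by (rule slit_charts_atE)
  have "fst (snd (slit_chart A c) w) \<in> chart_image c" using slit_base_in[OF c w] by simp
  note b = bilinear_lincomb[OF bilinear_lift_form[OF c this]]
  show "bilinear_form_on (tangent_space (slit_atlas A) w) (homogeneous_lift w)"
    unfolding bilinear_form_on_def
    by (intro allI ballI) (simp only: homogeneous_lift_eq[OF c w] slit.tangent_space_lincomb b simp_thms)
next
  fix w X Y
  assume "\<not> (w \<in> points (slit_atlas A) \<and> X \<in> tangent_space (slit_atlas A) w \<and>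
      Y \<in> tangent_space (slit_atlas A) w)"
  then show "homogeneous_lift w X Y = 0" by (auto simp: homogeneous_lift_def points_slit_atlas)
qed

lemma homogeneous_lift_tvec:
  assumes c: "c \<in> A" and w: "w \<in> fst (slit_chart A c)"
  shows "homogeneous_lift w (tvec (slit_atlas A) (slit_chart A c) w V)
      (tvec (slit_atlas A) (slit_chart A c) w W) = lift_form c (snd (slit_chart A c) w) V W"
proof -
  interpret slit: smooth_atlas "slit_atlas A" by (rule smooth_atlas_slit)
  have at: "slit_chart A c \<in> charts_at (slit_atlas A) w" using c w by (auto simp: charts_at_slit_iff)
  show ?thesis
    unfolding homogeneous_lift_eq[OF c w slit.tvec_in_tangent_space[OF at] slit.tvec_in_tangent_space[OF at]]
      slit.tvec_chart[OF at] ..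
qed

lemma smooth_homogeneous_lift: "smooth_field02 (slit_atlas A) homogeneous_lift"
  unfolding smooth_field02_def
proof (intro conjI ballI tensor_homogeneous_lift)
  interpret slit: smooth_atlas "slit_atlas A" by (rule smooth_atlas_slit)
  fix C and a b :: "'e \<times> 'e" assume C: "C \<in> slit_atlas A"
  then obtain c where c: "c \<in> A" "C = slit_chart A c" by (auto simp: slit_atlas_def)
  interpret C: metric_family "chart_image c" "metric_form A g c" by (rule metric_form_family[OF c(1)])
  show "smooth_on (chart_image C) (\<lambda>x. homogeneous_lift (chart_inv C x)
      (tvec (slit_atlas A) C (chart_inv C x) a) (tvec (slit_atlas A) C (chart_inv C x) b))"
  proof (rule smooth_on_cong[OF slit.open_chart_image[OF C]])
    show "smooth_on (chart_image C) (\<lambda>z. lift_form c z a b)"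
      unfolding c(2) slit_chart_image[OF c(1)] lift_form_def by (rule C.smooth_on_lift_B)
    show "lift_form c x a b = homogeneous_lift (chart_inv C x)
      (tvec (slit_atlas A) C (chart_inv C x) a) (tvec (slit_atlas A) C (chart_inv C x) b)"
      if "x \<in> chart_image C" for x
      using homogeneous_lift_tvec[OF c(1), of "chart_inv C x" a b] slit.chart_inv_in[OF that]
        slit.snd_chart_inv[OF that] unfolding c(2) by simp
  qed
qed

lemma symmetric_homogeneous_lift: "symmetric_field02 (slit_atlas A) homogeneous_lift"
  unfolding symmetric_field02_def
proof (intro ballI)
  fix w X Y assume "w \<in> points (slit_atlas A)"
    and X: "X \<in> tangent_space (slit_atlas A) w" and Y: "Y \<in> tangent_space (slit_atlas A) w"
  then obtain c where c: "c \<in> A" and w: "w \<in> fst (slit_chart A c)" by (auto elim: slit_charts_atE)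
  interpret C: metric_family "chart_image c" "metric_form A g c" by (rule metric_form_family[OF c])
  show "homogeneous_lift w X Y = homogeneous_lift w Y X"
    unfolding homogeneous_lift_eq[OF c w X Y] homogeneous_lift_eq[OF c w Y X] lift_form_def
    by (rule C.lift_B_sym) (simp add: slit_base_in[OF c w])
qed

lemma nondegenerate_homogeneous_lift: "nondegenerate_field02 (slit_atlas A) homogeneous_lift"
  unfolding nondegenerate_field02_def
proof (intro ballI impI)
  interpret slit: smooth_atlas "slit_atlas A" by (rule smooth_atlas_slit)
  fix w X assume "w \<in> points (slit_atlas A)"
    and X: "X \<in> tangent_space (slit_atlas A) w"
    and 0: "\<forall>Y\<in>tangent_space (slit_atlas A) w. homogeneous_lift w X Y = 0"
  then obtain c where c: "c \<in> A" and w: "w \<in> fst (slit_chart A c)" by (auto elim: slit_charts_atE)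
  interpret C: metric_family "chart_image c" "metric_form A g c" by (rule metric_form_family[OF c])
  have at: "slit_chart A c \<in> charts_at (slit_atlas A) w" using c w by (auto simp: charts_at_slit_iff)
  have "lift_form c (snd (slit_chart A c) w) (X (slit_chart A c)) W = 0" for W
    using 0 slit.tvec_in_tangent_space[OF at, of W]
      homogeneous_lift_eq[OF c w X slit.tvec_in_tangent_space[OF at, of W]]
    by (simp add: slit.tvec_chart[OF at])
  then have "X (slit_chart A c) = 0"
    unfolding lift_form_def
    by (intro C.lift_B_nondegenerate[of "snd (slit_chart A c) w"])
      (simp_all add: slit_base_in[OF c w] slit_chart_coordinate_nonzero[OF c w])
  then show "X = (\<lambda>_. 0)" using slit.tangent_space_eq_zero_iff[OF at X] by blast
qed

subsection \<open>Homogeneity\<close>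

lemma fiber_scaling_slit_chart:
  assumes c: "c \<in> A" and t: "t > 0" and w: "w \<in> fst (slit_chart A c)"
  shows "fiber_scaling t w \<in> fst (slit_chart A c)"
    and "snd (slit_chart A c) (fiber_scaling t w) = (snd c (fst w), t *\<^sub>R snd w c)"
proof -
  have tv: "snd w \<in> tangent_space A (fst w)" and nz: "snd w \<noteq> (\<lambda>_. 0)"
    using w by (auto simp: in_slit_chart[OF c] in_slit_bundle)
  have "(\<lambda>c. t *\<^sub>R snd w c) \<in> tangent_space A (fst w)"
    using tangent_space_lincomb[OF tv tv, of t 0] by simp
  moreover have "(\<lambda>c. t *\<^sub>R snd w c) \<noteq> (\<lambda>_. 0)"
    using nz t by (auto simp: fun_eq_iff)
  ultimately show "fiber_scaling t w \<in> fst (slit_chart A c)"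
    using w by (simp add: in_slit_chart[OF c] in_slit_bundle fiber_scaling_def split_beta)
  show "snd (slit_chart A c) (fiber_scaling t w) = (snd c (fst w), t *\<^sub>R snd w c)"
    by (simp add: fiber_scaling_def split_beta)
qed

lemma fiber_scaling_coordinates:
  assumes c: "c \<in> A" and t: "t > 0" and z: "z \<in> chart_image (slit_chart A c)"
  shows "fiber_scaling t (chart_inv (slit_chart A c) z) =
    chart_inv (slit_chart A c) (fst z, t *\<^sub>R snd z)"
proof -
  have x: "fst z \<in> chart_image c" and y: "snd z \<noteq> 0"
    using z unfolding slit_chart_image[OF c] by auto
  have "tvec A c (chart_inv c (fst z)) (t *\<^sub>R snd z) = (\<lambda>d. t *\<^sub>R tvec A c (chart_inv c (fst z)) (snd z) d)"
    using tvec_lincomb[OF charts_at_chart_inv[OF c x], of t "snd z" 0 0] by simp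
  then show ?thesis
    using slit_chart_inv[OF c x y] slit_chart_inv[OF c x, of "t *\<^sub>R snd z"] y t
    by (simp add: fiber_scaling_def)
qed

text \<open>\<open>tangent_map\<close> reads its argument in a chosen source chart, so the lemma
  hands out that chart. There the scaling is the linear map \<open>?m\<close>, equal to its own
  derivative, and any target chart is reached by one further transition.\<close>

lemma tangent_map_fiber_scaling:
  assumes t: "t > 0" and w: "w \<in> slit_bundle A"
  obtains c where "c \<in> A" "w \<in> fst (slit_chart A c)"
    "\<And>X. tangent_map (slit_atlas A) (slit_atlas A) (fiber_scaling t) w X =
      tvec (slit_atlas A) (slit_chart A c) (fiber_scaling t w)
        (fst (X (slit_chart A c)), t *\<^sub>R snd (X (slit_chart A c)))"
proof -
  interpret slit: smooth_atlas "slit_atlas A" by (rule smooth_atlas_slit)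
  define C where "C = (SOME C. C \<in> charts_at (slit_atlas A) w)"
  have "\<exists>C. C \<in> charts_at (slit_atlas A) w"
    using w slit.points_iff unfolding points_slit_atlas by blast
  then have at: "C \<in> charts_at (slit_atlas A) w" unfolding C_def by (rule someI_ex)
  then obtain c where c: "c \<in> A" "C = slit_chart A c" and wc: "w \<in> fst (slit_chart A c)"
    unfolding charts_at_slit_iff by blast
  have C: "C \<in> slit_atlas A" using c by (simp add: slit_atlas_def)
  let ?w = "fiber_scaling t w" and ?m = "\<lambda>z::'e \<times> 'e. (fst z, t *\<^sub>R snd z)"
  have w': "?w \<in> fst C" "snd C ?w = ?m (snd C w)"
    using fiber_scaling_slit_chart[OF c(1) t wc] unfolding c(2) by simp_all
  have m: "bounded_linear ?m"
    by (intro bounded_linear_Pair bounded_linear_fst bounded_linear_scaleR_right[THEN bounded_linear_compose]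
        bounded_linear_snd)
  have D: "frechet_derivative (snd D \<circ> fiber_scaling t \<circ> chart_inv C) (at (snd C w)) V =
      jacobian C D ?w (?m V)" if "D \<in> charts_at (slit_atlas A) ?w" for D V
  proof (rule frechet_derivative_apply)
    have D: "D \<in> slit_atlas A" "?w \<in> fst D" using that by (auto simp: charts_at_def)
    have "((\<lambda>z. (snd D \<circ> chart_inv C) (?m z)) has_derivative (\<lambda>V. jacobian C D ?w (?m V))) (at (snd C w))"
      unfolding w'(2)
      by (rule has_derivative_compose[OF bounded_linear_imp_has_derivative[OF m]])
        (rule slit.transition_has_derivative[OF C D(1) w'(1) D(2), unfolded w'(2)])
    then show "(snd D \<circ> fiber_scaling t \<circ> chart_inv C has_derivative (\<lambda>V. jacobian C D ?w (?m V))) (at (snd C w))"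
    proof (rule has_derivative_transform_within_open[OF _ slit.open_chart_image[OF C]])
      show "snd C w \<in> chart_image C" using wc unfolding c(2) chart_image_def by blast
      show "(snd D \<circ> chart_inv C) (?m z) = (snd D \<circ> fiber_scaling t \<circ> chart_inv C) z"
        if "z \<in> chart_image C" for z
        using fiber_scaling_coordinates[OF c(1) t] that unfolding c(2) by simp
    qed
  qed
  have "tangent_map (slit_atlas A) (slit_atlas A) (fiber_scaling t) w X =
      tvec (slit_atlas A) C ?w (?m (X C))" for X
    unfolding tangent_map_def tvec_def C_def[symmetric] Let_def using D by (intro ext) simp
  then show thesis using that[OF c(1) wc] unfolding c(2) by blast
qed

lemma homogeneous_lift_pullback:
  assumes t: "t > 0" and w: "w \<in> slit_bundle A"
    and X: "X \<in> tangent_space (slit_atlas A) w" and Y: "Y \<in> tangent_space (slit_atlas A) w"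
  shows "homogeneous_lift (fiber_scaling t w)
      (tangent_map (slit_atlas A) (slit_atlas A) (fiber_scaling t) w X)
      (tangent_map (slit_atlas A) (slit_atlas A) (fiber_scaling t) w Y) = homogeneous_lift w X Y"
proof -
  obtain c where c: "c \<in> A" and wc: "w \<in> fst (slit_chart A c)"
    and tm: "\<And>X. tangent_map (slit_atlas A) (slit_atlas A) (fiber_scaling t) w X =
      tvec (slit_atlas A) (slit_chart A c) (fiber_scaling t w)
        (fst (X (slit_chart A c)), t *\<^sub>R snd (X (slit_chart A c)))"
    using tangent_map_fiber_scaling[OF t w] by blast
  interpret C: metric_family "chart_image c" "metric_form A g c" by (rule metric_form_family[OF c])
  note w' = fiber_scaling_slit_chart[OF c t wc]
  have "fst (snd (slit_chart A c) w) \<in> chart_image c" using slit_base_in[OF c wc] by simp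
  from C.lift_B_homogeneous[OF this t] show ?thesis
    unfolding tm homogeneous_lift_tvec[OF c w'(1)] homogeneous_lift_eq[OF c wc X Y] w'(2) lift_form_def
    by simp
qed

lemma zero_homogeneous_homogeneous_lift: "zero_homogeneous A homogeneous_lift"
  unfolding zero_homogeneous_def
proof (intro allI impI ext)
  fix t :: real and w X Y assume t: "t > 0"
  show "pullback02 (slit_atlas A) (slit_atlas A) (fiber_scaling t) homogeneous_lift w X Y =
      homogeneous_lift w X Y"
  proof (cases "w \<in> slit_bundle A \<and> X \<in> tangent_space (slit_atlas A) w \<and> Y \<in> tangent_space (slit_atlas A) w")
    case True
    then show ?thesis by (simp add: pullback02_def points_slit_atlas homogeneous_lift_pullback[OF t])
  next
    case False
    then show ?thesis by (auto simp: pullback02_def points_slit_atlas homogeneous_lift_def)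
  qed
qed

end

section \<open>Adapted frames, uniqueness and index\<close>

lemma sum_Basis_axis: "(\<Sum>b\<in>Basis. f b) = (\<Sum>i\<in>UNIV. f (axis i (1::real) :: real^'n))"
proof -
  have B: "(Basis :: (real^'n) set) = range (\<lambda>i. axis i 1)" by (auto simp: Basis_vec_def)
  have "inj (\<lambda>i. axis i (1::real) :: real^'n)" by (auto simp: inj_on_def axis_eq_axis)
  from sum.reindex[OF this, of f] show ?thesis unfolding B o_def .
qed

lemma linear_expand_axis:
  fixes h :: "real^'n \<Rightarrow> 'f::real_vector"
  assumes "linear h"
  shows "h v = (\<Sum>i\<in>UNIV. v $ i *\<^sub>R h (axis i 1))"
  using linear_expand_Basis[OF assms, of v] unfolding sum_Basis_axis by (simp add: inner_axis)

lemma bilinear_expand_axis: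
  fixes f :: "real^'n \<Rightarrow> real^'n \<Rightarrow> real"
  assumes "bilinear f"
  shows "f u v = (\<Sum>i\<in>UNIV. \<Sum>j\<in>UNIV. u $ i * (v $ j * f (axis i 1) (axis j 1)))"
  using bilinear_expand_Basis[OF assms, of u v] unfolding sum_Basis_axis by (simp add: inner_axis)

text \<open>The argument of Sylvester's law of inertia: a subspace on which \<open>Q\<close> is
  negative meets \<open>P\<close> only in 0, so its dimension is at most the codimension of
  \<open>P\<close>, which is \<open>dim N\<close>.\<close>

lemma Max_dim_negative_definite:
  fixes Q :: "'v::euclidean_space \<Rightarrow> real"
  assumes N: "subspace N" "\<And>v. v \<in> N \<Longrightarrow> v \<noteq> 0 \<Longrightarrow> Q v < 0"
    and P: "subspace P" "\<And>v. v \<in> P \<Longrightarrow> v \<noteq> 0 \<Longrightarrow> Q v > 0"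
    and dim: "dim N + dim P = DIM('v)"
  shows "Max {dim S |S. subspace S \<and> (\<forall>v\<in>S. v \<noteq> 0 \<longrightarrow> Q v < 0)} = dim N"
proof -
  let ?D = "{dim S |S. subspace S \<and> (\<forall>v\<in>S. v \<noteq> 0 \<longrightarrow> Q v < 0)}"
  have le: "k \<le> dim N" if k: "k \<in> ?D" for k
  proof -
    obtain S where S: "k = dim S" "subspace S" "\<forall>v\<in>S. v \<noteq> 0 \<longrightarrow> Q v < 0" using k by blast
    have "v = 0" if "v \<in> S \<inter> P" for v
      using that S(3) P(2)[of v] by (metis IntD1 IntD2 less_asym)
    then have "S \<inter> P \<subseteq> {0}" by blast
    then have "dim (S \<inter> P) = 0" by (simp add: dim_eq_0)
    then have "dim S + dim P = dim {x + y |x y. x \<in> S \<and> y \<in> P}"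
      using dim_sums_Int[OF S(2) P(1)] by linarith
    also have "\<dots> \<le> DIM('v)" by (rule dim_subset_UNIV)
    finally show ?thesis using dim S(1) by linarith
  qed
  \<comment> \<open>\<open>Max\<close> is meaningful only for a finite set, so the bound serves here
    as well as for maximality.\<close>
  then have "finite ?D" by (meson finite_nat_set_iff_bounded_le)
  moreover have "dim N \<in> ?D" using N by blast
  ultimately show ?thesis using le by (intro Max_eqI)
qed

locale cartesian_riemannian_atlas = riemannian_atlas A T g
  for A :: "('a, real^'n) atlas" and T and g
begin

lemma metric_comp_eq: "metric_comp A g c i j x = metric_form A g c x (axis i 1) (axis j 1)"
  by (simp add: metric_comp_def metric_form_def Let_def)

lemma partial_metric_comp:
  assumes "c \<in> A"
  shows "partial k (metric_comp A g c i j) x = metric_deriv c x (axis k 1) (axis i 1) (axis j 1)"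
proof -
  interpret C: metric_family "chart_image c" "metric_form A g c" by (rule metric_form_family[OF assms])
  show ?thesis by (simp add: partial_def metric_deriv_def C.deriv_B_def metric_comp_eq[abs_def])
qed

text \<open>A vector in the kernel has vanishing square length. Invertibility gives
  \<open>matrix_inv\<close> in the Christoffel symbols its intended meaning, as
  \<open>christoffel_levi_civita\<close> requires.\<close>

lemma metric_comp_invertible:
  assumes c: "c \<in> A" and x: "x \<in> chart_image c"
  shows "invertible (\<chi> i j. metric_comp A g c i j x)"
proof -
  interpret C: metric_family "chart_image c" "metric_form A g c" by (rule metric_form_family[OF c])
  let ?M = "\<chi> i j. metric_comp A g c i j x"
  have "v = 0" if v: "?M *v v = 0" for v
  proof -
    have "metric_form A g c x v v = (\<Sum>i\<in>UNIV. v $ i * (?M *v v) $ i)"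
      by (simp add: bilinear_expand_axis[OF C.bilinear_B[OF x], of v v] matrix_vector_mult_def
          metric_comp_eq sum_distrib_left mult_ac)
    also have "\<dots> = 0" using v by simp
    finally show ?thesis using C.pos_B[OF x, of v] by (cases "v = 0") auto
  qed
  then show ?thesis unfolding invertible_left_inverse matrix_left_invertible_ker by blast
qed

lemma fiber_norm_eq:
  assumes c: "c \<in> A" and w: "w \<in> fst (slit_chart A c)"
  shows "fiber_norm A g c w = sqrt (metric_form A g c (snd c (fst w)) (snd w c) (snd w c))"
proof -
  interpret C: metric_family "chart_image c" "metric_form A g c" by (rule metric_form_family[OF c])
  show ?thesis
    by (simp add: fiber_norm_def metric_comp_eq mult_ac
        bilinear_expand_axis[OF C.bilinear_B[OF slit_base_in[OF c w]], of "snd w c" "snd w c"])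
qed

definition horizontal_vec :: "('a, real^'n) chart \<Rightarrow> (real^'n) \<times> (real^'n) \<Rightarrow> 'n \<Rightarrow> (real^'n) \<times> (real^'n)"
  where "horizontal_vec c z i =
    (axis i 1, \<chi> m. - (\<Sum>a\<in>UNIV. snd z $ a * christoffel A g c a i m (fst z)))"

lemma horizontal_frame_eq:
  "horizontal_frame A g c i w =
    tvec (slit_atlas A) (slit_chart A c) w (horizontal_vec c (snd (slit_chart A c) w) i)"
  by (simp add: horizontal_frame_def horizontal_vec_def)

text \<open>Compatibility of the Levi-Civita connection with \<open>g\<close> makes the horizontal
  distribution isotropic.\<close>

lemma lift_form_horizontal:
  assumes c: "c \<in> A" and z: "fst z \<in> chart_image c"
  shows "lift_form c z (horizontal_vec c z i) (horizontal_vec c z j) = 0"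
proof -
  interpret C: metric_family "chart_image c" "metric_form A g c" by (rule metric_form_family[OF c])
  let ?x = "fst z" and ?y = "snd z"
  let ?g = "\<lambda>i j. metric_comp A g c i j ?x" and ?\<Gamma> = "\<lambda>i j k. christoffel A g c i j k ?x"
  let ?K = "\<lambda>i. snd (horizontal_vec c z i)"
  have K: "?K i $ m = - (\<Sum>a\<in>UNIV. ?y $ a * ?\<Gamma> a i m)" for i m
    by (simp add: horizontal_vec_def)
  have lin: "linear (metric_form A g c ?x u)" "linear (\<lambda>u. metric_form A g c ?x u v)" for u v
    using C.bilinear_B[OF z] by (auto simp: bilinear_def)
  have 1: "metric_form A g c ?x (axis i 1) (?K j) = - (\<Sum>a\<in>UNIV. ?y $ a * (\<Sum>m\<in>UNIV. ?\<Gamma> a j m * ?g i m))"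
  proof -
    have "metric_form A g c ?x (axis i 1) (?K j) = (\<Sum>m\<in>UNIV. ?K j $ m * ?g i m)"
      using linear_expand_axis[OF lin(1), of "axis i 1" "?K j"] by (simp add: metric_comp_eq)
    also have "\<dots> = - (\<Sum>m\<in>UNIV. \<Sum>a\<in>UNIV. ?y $ a * (?\<Gamma> a j m * ?g i m))"
      by (simp add: K sum_negf sum_distrib_left sum_distrib_right mult_ac)
    also have "\<dots> = - (\<Sum>a\<in>UNIV. \<Sum>m\<in>UNIV. ?y $ a * (?\<Gamma> a j m * ?g i m))"
      by (subst sum.swap) (rule refl)
    finally show ?thesis by (simp add: sum_distrib_left)
  qed
  have 2: "metric_form A g c ?x (?K i) (axis j 1) = - (\<Sum>a\<in>UNIV. ?y $ a * (\<Sum>m\<in>UNIV. ?\<Gamma> a i m * ?g m j))"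
  proof -
    have "metric_form A g c ?x (?K i) (axis j 1) = (\<Sum>m\<in>UNIV. ?K i $ m * ?g m j)"
      using linear_expand_axis[OF lin(2), of "?K i" "axis j 1"] by (simp add: metric_comp_eq)
    also have "\<dots> = - (\<Sum>m\<in>UNIV. \<Sum>a\<in>UNIV. ?y $ a * (?\<Gamma> a i m * ?g m j))"
      by (simp add: K sum_negf sum_distrib_left sum_distrib_right mult_ac)
    also have "\<dots> = - (\<Sum>a\<in>UNIV. \<Sum>m\<in>UNIV. ?y $ a * (?\<Gamma> a i m * ?g m j))"
      by (subst sum.swap) (rule refl)
    finally show ?thesis by (simp add: sum_distrib_left)
  qed
  have "metric_deriv c ?x ?y (axis i 1) (axis j 1) =
      (\<Sum>a\<in>UNIV. ?y $ a * partial a (metric_comp A g c i j) ?x)"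
    using linear_expand_axis[OF C.linear_deriv_B[OF z], of ?y "axis i 1" "axis j 1"]
    by (simp add: partial_metric_comp[OF c] metric_deriv_def)
  also have "\<dots> = (\<Sum>a\<in>UNIV. ?y $ a *
      ((\<Sum>m\<in>UNIV. ?\<Gamma> a i m * ?g m j) + (\<Sum>m\<in>UNIV. ?\<Gamma> a j m * ?g i m)))"
  proof (intro sum.cong refl arg_cong2[of _ _ _ _ "(*)"])
    fix a
    show "partial a (metric_comp A g c i j) ?x =
        (\<Sum>m\<in>UNIV. ?\<Gamma> a i m * ?g m j) + (\<Sum>m\<in>UNIV. ?\<Gamma> a j m * ?g i m)"
      by (rule christoffel_levi_civita(2)[OF open_chart_image[OF c] z])
        (simp_all add: metric_comp_eq C.sym_B metric_comp_invertible[OF c z, unfolded metric_comp_eq])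
  qed
  \<comment> \<open>These two sums are the negatives of those in \<open>2\<close> and
    \<open>1\<close>, so the three summands of the lift cancel.\<close>
  finally have 3: "metric_deriv c ?x ?y (axis i 1) (axis j 1) =
      (\<Sum>a\<in>UNIV. ?y $ a * (\<Sum>m\<in>UNIV. ?\<Gamma> a i m * ?g m j)) +
      (\<Sum>a\<in>UNIV. ?y $ a * (\<Sum>m\<in>UNIV. ?\<Gamma> a j m * ?g i m))"
    by (simp add: distrib_left sum.distrib)
  have "fst (horizontal_vec c z i) = axis i 1" for i by (simp add: horizontal_vec_def)
  then show ?thesis
    unfolding lift_form_def C.lift_B_def using 1 2 3 by (simp add: metric_deriv_def)
qed

lemma lift_form_vertical:
  assumes c: "c \<in> A" and z: "fst z \<in> chart_image c"
  shows "lift_form c z (0, u) (0, v) = 0"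
    and "lift_form c z V (0, v) =
      2 / sqrt (metric_form A g c (fst z) (snd z) (snd z)) * metric_form A g c (fst z) (fst V) v"
proof -
  interpret C: metric_family "chart_image c" "metric_form A g c" by (rule metric_form_family[OF c])
  note zero = bilinear_rzero[OF C.bilinear_B[OF z]] bilinear_lzero[OF C.bilinear_B[OF z]]
    bilinear_rzero[OF C.bilinear_deriv_B[OF z]]
  show "lift_form c z (0, u) (0, v) = 0" by (simp add: lift_form_def C.lift_B_def zero)
  show "lift_form c z V (0, v) =
      2 / sqrt (metric_form A g c (fst z) (snd z) (snd z)) * metric_form A g c (fst z) (fst V) v"
    by (simp add: lift_form_def C.lift_B_def zero)
qed

lemma lift_form_sym:
  assumes c: "c \<in> A" and z: "fst z \<in> chart_image c"
  shows "lift_form c z V W = lift_form c z W V"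
proof -
  interpret C: metric_family "chart_image c" "metric_form A g c" by (rule metric_form_family[OF c])
  show ?thesis unfolding lift_form_def by (rule C.lift_B_sym[OF z])
qed

lemma is_homogeneous_lift_homogeneous_lift: "is_homogeneous_lift A g homogeneous_lift"
  unfolding is_homogeneous_lift_def Let_def
proof (intro conjI ballI allI tensor_homogeneous_lift)
  fix c w i j assume c: "c \<in> A" and w: "w \<in> fst (slit_chart A c)"
  let ?z = "snd (slit_chart A c) w"
  have z: "fst ?z \<in> chart_image c" using slit_base_in[OF c w] by simp
  note eqs = horizontal_frame_eq vertical_frame_def homogeneous_lift_tvec[OF c w]
  have h: "lift_form c ?z (horizontal_vec c ?z i) (0, axis j 1) =
      2 / fiber_norm A g c w * metric_comp A g c i j (snd c (fst w))"
    unfolding lift_form_vertical(2)[OF c z] fiber_norm_eq[OF c w] metric_comp_eq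
    by (simp add: horizontal_vec_def)
  show "homogeneous_lift w (horizontal_frame A g c i w) (horizontal_frame A g c j w) = 0"
    unfolding eqs by (rule lift_form_horizontal[OF c z])
  show "homogeneous_lift w (vertical_frame A c i w) (vertical_frame A c j w) = 0"
    unfolding eqs by (rule lift_form_vertical(1)[OF c z])
  show "homogeneous_lift w (horizontal_frame A g c i w) (vertical_frame A c j w) =
      2 / fiber_norm A g c w * metric_comp A g c i j (snd c (fst w))"
    unfolding eqs by (rule h)
  show "homogeneous_lift w (vertical_frame A c j w) (horizontal_frame A g c i w) =
      2 / fiber_norm A g c w * metric_comp A g c i j (snd c (fst w))"
    unfolding eqs lift_form_sym[OF c z, of "(0, axis j 1)"] by (rule h)
qed

definition horizontal_lift :: "('a, real^'n) chart \<Rightarrow> (real^'n) \<times> (real^'n) \<Rightarrow> real^'n \<Rightarrow> (real^'n) \<times> (real^'n)"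
  where "horizontal_lift c z u = (\<Sum>i\<in>UNIV. u $ i *\<^sub>R horizontal_vec c z i)"

lemma linear_horizontal_lift: "linear (horizontal_lift c z)"
  by (intro linearI)
    (simp_all add: horizontal_lift_def scaleR_add_left sum.distrib scaleR_right.sum)

lemma axis_expansion: "(\<Sum>i\<in>UNIV. u $ i *\<^sub>R axis i 1) = (u :: real^'n)"
  using linear_expand_axis[of "\<lambda>u. u" u] by (simp add: linear_iff)

lemma fst_horizontal_lift: "fst (horizontal_lift c z u) = u"
  by (simp add: horizontal_lift_def fst_sum horizontal_vec_def axis_expansion)

lemma horizontal_lift_axis: "horizontal_lift c z (axis i 1) = horizontal_vec c z i"
proof -
  have "horizontal_lift c z (axis i 1) = (\<Sum>j\<in>UNIV. if j = i then horizontal_vec c z j else 0)"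
    unfolding horizontal_lift_def by (rule sum.cong) (auto simp: axis_def)
  then show ?thesis by simp
qed

lemma vertical_expansion: "(0, v) = (\<Sum>i\<in>UNIV. v $ i *\<^sub>R (0 :: real^'n, axis i 1 :: real^'n))"
  by (rule linear_expand_axis[of "\<lambda>v. (0 :: real^'n, v)"]) (simp add: linear_iff)

lemma span_adapted_frame:
  "span (range (horizontal_vec c z) \<union> range (\<lambda>i. (0, axis i 1))) = UNIV" (is "span ?F = UNIV")
proof -
  have "V \<in> span ?F" for V
  proof -
    \<comment> \<open>The first component of \<open>V\<close> forces its horizontal part; the
      remainder has first component 0 and is vertical.\<close>
    let ?h = "horizontal_lift c z (fst V)" and ?v = "snd V - snd (horizontal_lift c z (fst V))"
    have "?h \<in> span ?F"
      unfolding horizontal_lift_def by (intro span_sum span_scale span_base) simp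
    moreover have "(0, ?v) \<in> span ?F"
      unfolding vertical_expansion[of ?v] by (intro span_sum span_scale span_base) simp
    ultimately have "?h + (0, ?v) \<in> span ?F" by (rule span_add)
    also have "?h + (0, ?v) = V" by (rule prod_eqI) (simp_all add: fst_horizontal_lift)
    finally show ?thesis .
  qed
  then show ?thesis by blast
qed

text \<open>Two bilinear forms that agree on a spanning set agree, and a single chart around each
  point provides such a set. Off the tangent spaces both fields vanish by normalization.\<close>

lemma is_homogeneous_lift_unique:
  assumes G: "is_homogeneous_lift A g G"
  shows "G = homogeneous_lift"
proof (intro ext)
  interpret slit: smooth_atlas "slit_atlas A" by (rule smooth_atlas_slit)
  have tensor: "tensor_field02 (slit_atlas A) G" using G by (simp add: is_homogeneous_lift_def)
  fix w X Y
  show "G w X Y = homogeneous_lift w X Y"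
  proof (cases "w \<in> points (slit_atlas A) \<and> X \<in> tangent_space (slit_atlas A) w \<and>
      Y \<in> tangent_space (slit_atlas A) w")
    case False
    then show ?thesis
      using tensor tensor_homogeneous_lift unfolding tensor_field02_def by metis
  next
    case True
    then obtain c where c: "c \<in> A" and w: "w \<in> fst (slit_chart A c)" by (auto elim: slit_charts_atE)
    let ?C = "slit_chart A c" and ?z = "snd (slit_chart A c) w"
    let ?t = "tvec (slit_atlas A) ?C w"
    have at: "?C \<in> charts_at (slit_atlas A) w" using c w by (auto simp: charts_at_slit_iff)
    let ?F = "range (horizontal_vec c ?z) \<union> range (\<lambda>i. (0, axis i 1))"
    let ?h = "\<lambda>i. horizontal_frame A g c i w" and ?v = "\<lambda>i. vertical_frame A c i w"
    have frame: "H w (?h i) (?h j) = 0" "H w (?v i) (?v j) = 0"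
      "H w (?h i) (?v j) = 2 / fiber_norm A g c w * metric_comp A g c i j (snd c (fst w))"
      "H w (?v j) (?h i) = 2 / fiber_norm A g c w * metric_comp A g c i j (snd c (fst w))"
      if "is_homogeneous_lift A g H" for H i j
      using that c w unfolding is_homogeneous_lift_def Let_def by blast+
    note frame_eqs = frame[OF G, unfolded horizontal_frame_eq vertical_frame_def]
      frame[OF is_homogeneous_lift_homogeneous_lift, unfolded horizontal_frame_eq vertical_frame_def]
    have eq: "G w (?t V) (?t W) = homogeneous_lift w (?t V) (?t W)" if "V \<in> ?F" "W \<in> ?F" for V W
      using that by (elim UnE rangeE) (simp_all only: frame_eqs)
    have span: "UNIV \<subseteq> span ?F" by (simp only: span_adapted_frame subset_UNIV)
    have "G w (?t (X ?C)) (?t (Y ?C)) = homogeneous_lift w (?t (X ?C)) (?t (Y ?C))"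
      by (rule bilinear_eq[OF slit.field02_bilinear[OF tensor at]
          slit.field02_bilinear[OF tensor_homogeneous_lift at] span span UNIV_I UNIV_I]) (rule eq)
    then show ?thesis using True by (simp only: slit.tangent_space_tvec[OF at])
  qed
qed

lemma lift_form_horizontal_lift:
  assumes c: "c \<in> A" and z: "fst z \<in> chart_image c"
  shows "lift_form c z (horizontal_lift c z u) (horizontal_lift c z v) = 0"
proof -
  have "bilinear (\<lambda>u v. lift_form c z (horizontal_lift c z u) (horizontal_lift c z v))"
    using bilinear_lift_form[OF c z] linear_compose[OF linear_horizontal_lift, of _ c z, unfolded o_def]
    unfolding bilinear_def by blast
  from bilinear_expand_axis[OF this, of u v] show ?thesis
    by (simp add: horizontal_lift_axis lift_form_horizontal[OF c z])
qed

text \<open>The graph subspaces \<open>{u\<^sup>h + s u\<^sup>v}\<close> for \<open>s = 1\<close> and \<open>s = -1\<close> are definite of dimension \<open>n\<close>,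
  with opposite signs.\<close>

lemma form_index_homogeneous_lift:
  assumes c: "c \<in> A" and w: "w \<in> fst (slit_chart A c)"
  shows "form_index (slit_atlas A) homogeneous_lift (slit_chart A c) w = CARD('n)"
proof -
  let ?z = "snd (slit_chart A c) w"
  interpret C: metric_family "chart_image c" "metric_form A g c" by (rule metric_form_family[OF c])
  have z: "fst ?z \<in> chart_image c" using slit_base_in[OF c w] by simp
  have y: "snd ?z \<noteq> 0" using slit_chart_coordinate_nonzero[OF c w] by simp
  let ?r = "2 / sqrt (metric_form A g c (fst ?z) (snd ?z) (snd ?z))"
  have r: "?r > 0" using C.sqrt_B_pos[OF z y] by simp
  let ?L = "lift_form c ?z"
  note bil = bilinear_lift_form[OF c z]
  \<comment> \<open>The horizontal and the vertical summand are both isotropic, so the lift on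
    \<open>m s u\<close> is twice the mixed term, whose sign is that of \<open>s\<close> for
    \<open>u \<noteq> 0\<close>.\<close>
  define m where "m s u = horizontal_lift c ?z u + (0, s *\<^sub>R u)" for s :: real and u
  have lin: "linear (m s)" for s
    unfolding m_def
    by (intro linear_compose_add linear_horizontal_lift linearI) (simp_all add: scaleR_add_right)
  have fst_m: "fst (m s u) = u" for s u by (simp add: m_def fst_horizontal_lift)
  have Q: "?L (m s u) (m s u) = 2 * s * (?r * metric_form A g c (fst ?z) u u)" for s u
  proof -
    let ?h = "horizontal_lift c ?z u" and ?v = "(0, s *\<^sub>R u)"
    have hv: "?L ?h ?v = s * (?r * metric_form A g c (fst ?z) u u)"
      unfolding lift_form_vertical(2)[OF c z] fst_horizontal_lift
      by (simp add: bilinear_rmul[OF C.bilinear_B[OF z[unfolded slit_chart_apply fst_conv]]])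
    have "?L (m s u) (m s u) = ?L ?h ?h + ?L ?h ?v + (?L ?v ?h + ?L ?v ?v)"
      by (simp only: m_def bilinear_ladd[OF bil] bilinear_radd[OF bil] add_ac)
    also have "\<dots> = 2 * s * (?r * metric_form A g c (fst ?z) u u)"
      unfolding lift_form_horizontal_lift[OF c z] lift_form_vertical(1)[OF c z]
        lift_form_sym[OF c z, of ?v ?h] hv by simp
    finally show ?thesis .
  qed
  have sub: "subspace (range (m s))" for s
    by (rule linear_subspace_image[OF lin subspace_UNIV])
  have dim: "dim (range (m s)) = CARD('n)" for s
  proof -
    have "inj (m s)" by (metis fst_m injI)
    then have "dim (range (m s)) = dim (UNIV :: (real^'n) set)"
      by (intro dim_image_eq lin) simp
    then show ?thesis by simp
  qed
  have pos: "?r * metric_form A g c (fst ?z) (fst V) (fst V) > 0" if "V \<in> range (m s)" "V \<noteq> 0" for V s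
  proof -
    have "fst V \<noteq> 0" using that fst_m linear_0[OF lin] by (metis rangeE)
    then show ?thesis using r C.pos_B[OF z] by (intro mult_pos_pos)
  qed
  have val: "?L V V = 2 * s * (?r * metric_form A g c (fst ?z) (fst V) (fst V))" if "V \<in> range (m s)" for V s
    using that Q fst_m by (metis rangeE)
  \<comment> \<open>The choices \<open>s = - 1\<close> and \<open>s = 1\<close> give the negative
    and the positive subspace. Each is a graph over the base directions, so the dimensions add up to
    that of the model space of the slit bundle.\<close>
  have "Max {dim S |S. subspace S \<and> (\<forall>V\<in>S. V \<noteq> 0 \<longrightarrow> ?L V V < 0)} = dim (range (m (- 1)))"
  proof (rule Max_dim_negative_definite)
    show "?L V V < 0" if "V \<in> range (m (- 1))" "V \<noteq> 0" for V
      unfolding val[OF that(1)] using pos[OF that] by linarith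
    show "?L V V > 0" if "V \<in> range (m 1)" "V \<noteq> 0" for V
      unfolding val[OF that(1)] using pos[OF that] by linarith
    show "dim (range (m (- 1))) + dim (range (m 1)) = DIM((real^'n) \<times> (real^'n))"
      by (simp add: dim)
  qed (rule sub)+
  then show ?thesis unfolding form_index_def homogeneous_lift_tvec[OF c w] dim .
qed

lemma pseudo_riemannian_homogeneous_lift:
  "pseudo_riemannian_manifold (slit_topology A) (slit_atlas A) homogeneous_lift"
  unfolding pseudo_riemannian_manifold_def
proof (intro conjI exI[of _ "CARD('n)"] ballI)
  fix w C assume "C \<in> charts_at (slit_atlas A) w"
  then show "form_index (slit_atlas A) homogeneous_lift C w = CARD('n)"
    unfolding charts_at_slit_iff using form_index_homogeneous_lift by blast
qed (rule smooth_manifold_slit smooth_homogeneous_lift symmetric_homogeneous_lift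
    nondegenerate_homogeneous_lift)+

end

theorem theorem2:
  fixes T :: "'a topology"
    and A :: "('a, real^'n) atlas"
    and g :: "('a, real^'n) field02"
  assumes "riemannian_manifold T A g"
  shows "(\<exists>!G. is_homogeneous_lift A g G) \<and>
    (\<forall>G. is_homogeneous_lift A g G \<longrightarrow>
       pseudo_riemannian_manifold (slit_topology A) (slit_atlas A) G \<and>
       zero_homogeneous A G)"
proof -
  have T: "smooth_manifold T A" using assms by (simp add: riemannian_manifold_def)
  interpret cartesian_riemannian_atlas A T g
    by (intro cartesian_riemannian_atlas.intro riemannian_atlas.intro manifold_atlas.intro
        manifold_atlas_axioms.intro riemannian_atlas_axioms.intro smooth_manifold_atlas[OF T] T assms)
  show ?thesis
    using is_homogeneous_lift_homogeneous_lift is_homogeneous_lift_unique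
      pseudo_riemannian_homogeneous_lift zero_homogeneous_homogeneous_lift by metis
qed

end
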